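(* Let $n\ge 2$, let $\varepsilon\in(0,1)$ and let $P$ be any positive integer. There is a quantum algorithm that, given black-box access to an $n$-qubit unitary $U_a$ and its inverse $U_a^\dagger$ satisfying $$U_a\lvert 0\rangle^{\otimes n}=\sqrt{1-a}\,\lvert\psi_0\rangle\lvert 0\rangle+\sqrt{a}\,\lvert\psi_1\rangle\lvert 1\rangle$$ for some unknown $a\in[0,1]$ and unknown $(n-1)$-qubit states $\lvert\psi_0\rangle,\lvert\psi_1\rangle$, outputs an estimate $\hat a$ with root mean squared error $\sqrt{\mathbb E[(\hat a-a)^2]}<\varepsilon$, for every $a\in[0,1]$. It uses a total of $N=\mathcal O(1/\varepsilon+P\log P)$ queries to $U_a$ and $U_a^\dagger$, and all quantum circuits it runs act on at most $P(n+1)$ qubits and have circuit depth $\mathcal O\big(1/(\varepsilon P)+\log P\big)$. In particular, taking $P=\lceil 1/\varepsilon\rceil$, it uses $N=\mathcal O(\varepsilon^{-1}\log(1/\varepsilon))$ queries and $\lceil 1/\varepsilon\rceil(n+1)$-qubit circuits of depth $\mathcal O(\log(1/\varepsilon))$.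
   Context: The queries are to $U_a$ and $U_a^\dagger$ themselves, which are not controlled; other gates (reflections, single-qubit rotations, controlled versions of known gates, GHZ-state preparation, measurements) are free. "Circuit depth" means the number of sequential applications of $U_a$ and $U_a^\dagger$ in a single circuit, plus the depth of the auxiliary layers. The circuits consist of preparing a $P$-qubit GHZ state $(\lvert0\rangle^{\otimes P}+\lvert1\rangle^{\otimes P})/\sqrt2$ on ancilla qubits, followed by $P$ separate $(n+1)$-qubit circuits, each acting on one ancilla qubit and one fresh $n$-qubit register, and single-qubit measurements. The RMSE is taken over the randomness of the measurement outcomes. *)

theory Defs
  imports "Jordan_Normal_Form.Matrix" "HOL-Library.FuncSet" Complex_Main
begin

text \<open>Qubit conventions. An m-qubit state is a complex vector of dimension 2^m; basis
index i corresponds to the bit string of i written big-endian (the first qubit is the most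
significant bit, the last qubit is the least significant bit).\<close>

definition cadj :: "complex mat \<Rightarrow> complex mat" where
  "cadj M = mat (dim_col M) (dim_row M) (\<lambda>(i,j). cnj (M $$ (j,i)))"

definition is_unitary :: "nat \<Rightarrow> complex mat \<Rightarrow> bool" where
  "is_unitary d M \<longleftrightarrow> M \<in> carrier_mat d d \<and> M * cadj M = 1\<^sub>m d \<and> cadj M * M = 1\<^sub>m d"

definition is_state :: "nat \<Rightarrow> complex vec \<Rightarrow> bool" where
  "is_state m v \<longleftrightarrow> v \<in> carrier_vec (2 ^ m) \<and> (\<Sum>i<2 ^ m. (cmod (v $ i))\<^sup>2) = 1"

text \<open>The oracle hypothesis: U is an n-qubit unitary with
  U |0^n> = sqrt(1-a) |psi0>|0> + sqrt(a) |psi1>|1>,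
  psi0, psi1 (n-1)-qubit states; the flag is the last qubit.\<close>
definition amp_oracle :: "nat \<Rightarrow> real \<Rightarrow> complex mat \<Rightarrow> bool" where
  "amp_oracle n a U \<longleftrightarrow> is_unitary (2 ^ n) U \<and>
     (\<exists>\<psi>0 \<psi>1. is_state (n - 1) \<psi>0 \<and> is_state (n - 1) \<psi>1 \<and>
        U *\<^sub>v unit_vec (2 ^ n) 0 =
          vec (2 ^ n) (\<lambda>i. if even i then complex_of_real (sqrt (1 - a)) * \<psi>0 $ (i div 2)
                                    else complex_of_real (sqrt a) * \<psi>1 $ (i div 2)))"

text \<open>A step of an (n+1)-qubit circuit (one ancilla qubit, the first qubit, and one
n-qubit register): either a free (known) unitary gate on the n+1 qubits, or one
(uncontrolled) query to U_a (Query False) or to its inverse (Query True) on the register.\<close>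
datatype step = Gate "complex mat" | Query bool

definition lift_reg :: "nat \<Rightarrow> complex mat \<Rightarrow> complex mat" where
  "lift_reg n M = mat (2 ^ (n+1)) (2 ^ (n+1))
     (\<lambda>(i,j). if i div 2 ^ n = j div 2 ^ n then M $$ (i mod 2 ^ n, j mod 2 ^ n) else 0)"

fun step_mat :: "nat \<Rightarrow> complex mat \<Rightarrow> step \<Rightarrow> complex mat" where
  "step_mat n U (Gate G) = G"
| "step_mat n U (Query b) = lift_reg n (if b then cadj U else U)"

definition run_circ :: "nat \<Rightarrow> complex mat \<Rightarrow> step list \<Rightarrow> complex vec \<Rightarrow> complex vec" where
  "run_circ n U cs v = foldl (\<lambda>w s. step_mat n U s *\<^sub>v w) v cs"

fun is_query :: "step \<Rightarrow> bool" where
  "is_query (Gate _) = False" | "is_query (Query _) = True"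

text \<open>A round = one quantum circuit: p ancillas prepared in the GHZ state, p separate
(n+1)-qubit circuits C 0, ..., C (p-1), each on ancilla j and a fresh n-qubit register
initialised to |0^n>, then every qubit is measured (single-qubit measurements; measurements
in other bases are obtained by free rotations inside C j).  An outcome is a function o with
o j \<in> {..<2^(n+1)} the measured bit string of block j (j < p).\<close>
type_synonym round = "nat \<times> (nat \<Rightarrow> step list)"
type_synonym outcome = "nat \<Rightarrow> nat"

definition outcomes :: "nat \<Rightarrow> round \<Rightarrow> outcome set" where
  "outcomes n r = PiE {..<fst r} (\<lambda>_. {..<2 ^ (n+1)})"

definition round_amp :: "nat \<Rightarrow> complex mat \<Rightarrow> round \<Rightarrow> outcome \<Rightarrow> complex" where
  "round_amp n U r x =
     (let p = fst r; C = snd r in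
      complex_of_real (1 / sqrt 2) *
        ((\<Prod>j<p. run_circ n U (C j) (unit_vec (2 ^ (n+1)) 0) $ x j)
       + (\<Prod>j<p. run_circ n U (C j) (unit_vec (2 ^ (n+1)) (2 ^ n)) $ x j)))"

definition round_prob :: "nat \<Rightarrow> complex mat \<Rightarrow> round \<Rightarrow> outcome \<Rightarrow> real" where
  "round_prob n U r x = (cmod (round_amp n U r x))\<^sup>2"

definition round_queries :: "round \<Rightarrow> nat" where
  "round_queries r = (\<Sum>j<fst r. length (filter is_query (snd r j)))"

text \<open>Depth: depth of the GHZ preparation (a CNOT tree of depth ceil(log2 p)) plus the
number of sequential layers of the deepest block circuit (each query and each free gate
counts as one layer).\<close>
definition round_depth :: "round \<Rightarrow> nat" where
  "round_depth r = nat \<lceil>log 2 (real (fst r))\<rceil> + Max ((\<lambda>j. length (snd r j)) ` {..<fst r})"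

definition round_ok :: "nat \<Rightarrow> nat \<Rightarrow> round \<Rightarrow> bool" where
  "round_ok n P r \<longleftrightarrow> 1 \<le> fst r \<and> fst r \<le> P \<and>
     (\<forall>j<fst r. \<forall>G. Gate G \<in> set (snd r j) \<longrightarrow> is_unitary (2 ^ (n+1)) G)"

text \<open>An (adaptive) algorithm: a number R of rounds, the choice of the next circuit as a
function of the outcomes observed so far, and a classical estimator of the full history.
It is a black-box algorithm: it is chosen independently of U.\<close>
type_synonym algo = "nat \<times> (outcome list \<Rightarrow> round) \<times> (outcome list \<Rightarrow> real)"

definition algo_ok :: "nat \<Rightarrow> nat \<Rightarrow> algo \<Rightarrow> bool" where
  "algo_ok n P A \<longleftrightarrow> (\<forall>h. round_ok n P (fst (snd A) h))"

definition algo_queries_le :: "algo \<Rightarrow> real \<Rightarrow> bool" where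
  "algo_queries_le A N \<longleftrightarrow>
     (\<forall>hs. length hs = fst A \<longrightarrow>
        real (\<Sum>k<fst A. round_queries (fst (snd A) (take k hs))) \<le> N)"

definition algo_depth_le :: "algo \<Rightarrow> real \<Rightarrow> bool" where
  "algo_depth_le A D \<longleftrightarrow> (\<forall>h. real (round_depth (fst (snd A) h)) \<le> D)"

fun cond_sq_err :: "nat \<Rightarrow> complex mat \<Rightarrow> real \<Rightarrow> algo \<Rightarrow> nat \<Rightarrow> outcome list \<Rightarrow> real" where
  "cond_sq_err n U a A 0 h = (snd (snd A) h - a)\<^sup>2"
| "cond_sq_err n U a A (Suc r) h =
     (\<Sum>x\<in>outcomes n (fst (snd A) h).
        round_prob n U (fst (snd A) h) x * cond_sq_err n U a A r (h @ [x]))"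

definition mse :: "nat \<Rightarrow> complex mat \<Rightarrow> real \<Rightarrow> algo \<Rightarrow> real" where
  "mse n U a A = cond_sq_err n U a A (fst A) []"

end

(*
  Let c = 1 - 2a. On the span of |0^n> and its image under the flag reflection W = U^dagger Z U,
  both W and the phase about |0^n> act as 2x2 matrices depending only on c, and exp(i t W) costs
  one query to U and one to its inverse. If c is already known to be close to c0, then four
  factors exp(i pi/4 W), interleaved with phases calibrated at c0, multiply |0^n> by
  exp(2i(c - c0)) up to an error O((c - c0)^2). Running m such gadgets in the |1>-branch of each
  of p GHZ blocks, the parity of the ancillas (scored 0 as soon as some register has left |0^n>)
  has mean sin(K (c - c0)) + O(K (c - c0)^2) with K = 2mp, so the average score of a batch
  refines c0.

  Stage j doubles K and halves the radius of confidence. By a Chernoff bound a batch fails with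
  exponentially small probability, and whatever happens later the estimate moves by at most the
  sum of the remaining 1/K. Letting the batch size grow linearly in the number of remaining stages
  makes both the mean squared error and the number of queries geometric sums. The calibration
  being adaptive, a gadget has constant depth, and the whole algorithm uses O(1/epsilon) queries.
*)
theory Submission
  imports Defs "HOL-Analysis.Product_Vector"
begin

section \<open>The calibrated phase gadget in two dimensions\<close>

text \<open>The rotation angle of an amplitude amplification iterate is the arccosine of
  \<open>c\<close>, whose slope is unbounded at \<open>c = 1\<close> and \<open>c = -1\<close>; a
  phase linear in \<open>c\<close> makes the estimates uniform in \<open>a\<close>. Queries cannot
  be controlled, so only known phases depend on the ancilla, and in the idle branch each query to
  \<open>U\<close> is undone by the inverse query that follows. The mean parity of \<open>p\<close>
  blocks is governed by the \<open>p\<close>-th power of one amplitude, so amplitude errors add up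
  \<open>p\<close> times; at distance \<open>1 / K\<close> from the truth a bias of order
  \<open>1 / K\<close> results. Linearising the sine costs at most another 1/6 there, so from
  \<open>K = 128\<close> on the total bias is below 1/4. This is half of \<open>K\<close> times the
  next radius, and the other half is left to statistical fluctuation. Below that gain a Hadamard
  test of the flag reflection, unbiased for every \<open>c\<close>, takes the radius from 1 to 1/128
  in one stage.\<close>

definition sig_rot :: "real \<Rightarrow> real \<Rightarrow> complex \<Rightarrow> complex \<times> complex \<Rightarrow> complex \<times> complex" where
  "sig_rot c s z v =
     (of_real (Re z) * fst v + \<i> * of_real (Im z) * (of_real c * fst v + of_real s * snd v),
      of_real (Re z) * snd v + \<i> * of_real (Im z) * (of_real s * fst v - of_real c * snd v))"

definition phases :: "complex \<Rightarrow> complex \<Rightarrow> complex \<times> complex \<Rightarrow> complex \<times> complex" where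
  "phases z1 z2 v = (z1 * fst v, z2 * snd v)"

text \<open>The product type is only a real vector space, so \<open>phases z z\<close> plays the
  role of multiplication by the scalar \<open>z\<close>. Differences are the form in which the
  telescoping estimate uses additivity.\<close>

definition linear_isometry :: "(complex \<times> complex \<Rightarrow> complex \<times> complex) \<Rightarrow> bool" where
  "linear_isometry T \<longleftrightarrow> (\<forall>v w. T (v - w) = T v - T w) \<and> (\<forall>z v. T (phases z z v) = phases z z (T v))
     \<and> (\<forall>v. norm (T v) = norm v)"

lemma linear_isometryI:
  assumes "\<And>v w. T (v - w) = T v - T w" "\<And>z v. T (phases z z v) = phases z z (T v)"
    "\<And>v. norm (T v) = norm v"
  shows "linear_isometry T"
  unfolding linear_isometry_def by (intro conjI allI assms)

lemma linear_isometryD: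
  assumes "linear_isometry T"
  shows "T (v - w) = T v - T w" "T (phases z z v) = phases z z (T v)" "norm (T v) = norm v"
  using assms by (simp_all only: linear_isometry_def)

text \<open>The matrix with columns \<open>(A, B)\<close> and \<open>(- cnj B, cnj A)\<close> is a
  scalar multiple of a special unitary one; \<open>sig_rot\<close> has this shape.\<close>

lemma su2_norm:
  fixes A B x y :: complex
  shows "(cmod (A * x - cnj B * y))\<^sup>2 + (cmod (B * x + cnj A * y))\<^sup>2
    = ((cmod A)\<^sup>2 + (cmod B)\<^sup>2) * ((cmod x)\<^sup>2 + (cmod y)\<^sup>2)"
proof -
  have "complex_of_real ((cmod (A * x - cnj B * y))\<^sup>2 + (cmod (B * x + cnj A * y))\<^sup>2)
    = of_real (((cmod A)\<^sup>2 + (cmod B)\<^sup>2) * ((cmod x)\<^sup>2 + (cmod y)\<^sup>2))"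
    unfolding of_real_add of_real_mult complex_norm_square by (simp add: algebra_simps)
  then show ?thesis unfolding of_real_eq_iff .
qed

lemma linear_isometry_sig_rot:
  assumes "cmod z = 1" "c\<^sup>2 + s\<^sup>2 = 1"
  shows "linear_isometry (sig_rot c s z)"
proof -
  have z: "(Re z)\<^sup>2 + (Im z)\<^sup>2 = 1"
    using assms(1) by (metis cmod_power2 one_power2)
  have "norm (sig_rot c s z v) = norm v" for v
  proof -
    let ?A = "Complex (Re z) (Im z * c)" and ?B = "Complex 0 (Im z * s)"
    have "sig_rot c s z v = (?A * fst v - cnj ?B * snd v, ?B * fst v + cnj ?A * snd v)"
      by (simp add: sig_rot_def complex_eq_iff algebra_simps)
    then have "(cmod (fst (sig_rot c s z v)))\<^sup>2 + (cmod (snd (sig_rot c s z v)))\<^sup>2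
      = ((cmod ?A)\<^sup>2 + (cmod ?B)\<^sup>2) * ((cmod (fst v))\<^sup>2 + (cmod (snd v))\<^sup>2)"
      by (simp only: fst_conv snd_conv su2_norm)
    moreover have "(cmod ?A)\<^sup>2 + (cmod ?B)\<^sup>2 = (Re z)\<^sup>2 + (Im z)\<^sup>2 * (c\<^sup>2 + s\<^sup>2)"
      by (simp add: cmod_power2 power_mult_distrib algebra_simps)
    ultimately have "(cmod (fst (sig_rot c s z v)))\<^sup>2 + (cmod (snd (sig_rot c s z v)))\<^sup>2
      = (cmod (fst v))\<^sup>2 + (cmod (snd v))\<^sup>2"
      using z assms(2) by simp
    then show ?thesis by (simp add: norm_prod_def)
  qed
  then show ?thesis
    by (intro linear_isometryI) (simp_all add: sig_rot_def phases_def algebra_simps)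
qed

lemma linear_isometry_phases:
  assumes "cmod z1 = 1" "cmod z2 = 1"
  shows "linear_isometry (phases z1 z2)"
  by (rule linear_isometryI) (simp_all add: phases_def norm_prod_def norm_mult assms right_diff_distrib)

lemma linear_isometry_comp:
  "linear_isometry S \<Longrightarrow> linear_isometry T \<Longrightarrow> linear_isometry (\<lambda>v. S (T v))"
  by (rule linear_isometryI) (simp_all only: linear_isometryD)

lemma norm_phases: "cmod z = 1 \<Longrightarrow> norm (phases z z v) = norm v"
  by (simp add: phases_def norm_prod_def norm_mult)

lemma linear_isometry_funpow: "linear_isometry T \<Longrightarrow> linear_isometry (T ^^ m)"
proof (induction m)
  case 0
  then show ?case by (simp add: linear_isometry_def)
next
  case (Suc m)
  then show ?case
    using linear_isometry_comp[of T "T ^^ m"] by (simp add: comp_def)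
qed

lemma norm_linear_isometry_funpow:
  "linear_isometry T \<Longrightarrow> norm ((T ^^ m) v) = norm v"
  by (induction m) (simp_all add: linear_isometryD)

text \<open>Telescoping: an isometry transports the errors already made without enlarging them, so
  they add up linearly. Closeness to a phase is required at the single vector \<open>v\<close> only,
  an approximate eigenvector.\<close>

lemma linear_isometry_funpow_near_phase:
  assumes T: "linear_isometry T" and z: "cmod z = 1"
    and near: "norm (T v - phases z z v) \<le> e"
  shows "norm ((T ^^ m) v - phases (z ^ m) (z ^ m) v) \<le> real m * e"
proof (induction m)
  case 0
  then show ?case by (simp add: phases_def)
next
  case (Suc m)
  let ?w = "phases (z ^ m) (z ^ m) v"
  have "(T ^^ Suc m) v - phases (z ^ Suc m) (z ^ Suc m) v
      = T ((T ^^ m) v - ?w) + phases (z ^ m) (z ^ m) (T v - phases z z v)"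
  proof -
    have "T ?w = phases (z ^ m) (z ^ m) (T v)" by (rule linear_isometryD[OF T])
    then show ?thesis
      by (simp add: linear_isometryD[OF T]) (simp add: phases_def prod_eq_iff algebra_simps)
  qed
  also have "norm \<dots> \<le> norm ((T ^^ m) v - ?w) + norm (T v - phases z z v)"
    using norm_triangle_ineq[of "T ((T ^^ m) v - ?w)"
        "phases (z ^ m) (z ^ m) (T v - phases z z v)"] z
    by (simp add: linear_isometryD(3)[OF T] norm_phases norm_power)
  finally show ?case using Suc near by (simp add: algebra_simps)
qed

text \<open>For a calibration phase \<open>b\<close>, the amplitude that the gadget leaks out of
  \<open>(1, 0)\<close> is proportional to \<open>b^2 * (1 + i c) + (1 - i c)\<close>. It vanishes
  at \<open>c = c0\<close> iff \<open>b^2 = (c0 + i) / (c0 - i)\<close>; this is a unit square root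
  of that number.\<close>

definition calib :: "real \<Rightarrow> complex" where
  "calib c0 = Complex c0 1 / of_real (sqrt (1 + c0\<^sup>2))"

text \<open>With the phases \<^term>\<open>calib c0\<close>, the off-diagonal entry of this map is proportional to
  \<^term>\<open>s * (c - c0)\<close>: the leakage out of the first basis vector vanishes at \<^term>\<open>c = c0\<close>, uniformly
  up to the endpoints where \<^term>\<open>s = 0\<close>. The sign in \<^term>\<open>- cnj (calib c0)\<close> makes the first-order
  leakage of two consecutive applications cancel, so that it becomes quadratic in \<^term>\<open>c - c0\<close>.\<close>
definition macro :: "real \<Rightarrow> real \<Rightarrow> real \<Rightarrow> complex \<times> complex \<Rightarrow> complex \<times> complex" where
  "macro c s c0 v = sig_rot c s (cis (pi/4)) (phases (calib c0) (cnj (calib c0))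
     (sig_rot c s (cis (pi/4)) (phases (calib c0) (- cnj (calib c0)) v)))"

lemma norm_calib [simp]: "cmod (calib c0) = 1"
proof -
  have "0 < sqrt (1 + c0\<^sup>2)"
    by (simp add: add_pos_nonneg)
  moreover have "cmod (Complex c0 1) = sqrt (1 + c0\<^sup>2)"
    by (simp add: cmod_def add.commute)
  ultimately show ?thesis
    unfolding calib_def norm_divide norm_of_real by simp
qed

lemma linear_isometry_macro:
  assumes "c\<^sup>2 + s\<^sup>2 = 1"
  shows "linear_isometry (macro c s c0)"
proof -
  have S: "linear_isometry (sig_rot c s (cis (pi/4)))"
    using assms by (intro linear_isometry_sig_rot) auto
  have P: "linear_isometry (phases (calib c0) (cnj (calib c0)))"
    "linear_isometry (phases (calib c0) (- cnj (calib c0)))"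
    by (simp_all add: linear_isometry_phases)
  show ?thesis
    unfolding macro_def[abs_def]
    by (rule linear_isometry_comp[OF S linear_isometry_comp[OF P(1) linear_isometry_comp[OF S P(2)]]])
qed

lemma calib_cnj: "calib c0 * cnj (calib c0) = 1"
  using complex_norm_square[of "calib c0"] by simp

lemma calib_sq: "calib c0 * calib c0 = Complex c0 1 / Complex c0 (-1)"
proof -
  have *: "Complex c0 1 * Complex c0 (-1) = of_real (1 + c0\<^sup>2)"
    by (simp add: complex_eq_iff power2_eq_square)
  have nz: "Complex c0 (-1) \<noteq> 0" "Complex c0 1 \<noteq> 0" by (simp_all add: complex_eq_iff)
  have "complex_of_real (sqrt (1 + c0\<^sup>2)) * of_real (sqrt (1 + c0\<^sup>2)) = of_real (1 + c0\<^sup>2)"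
    by (simp flip: of_real_mult of_real_add)
  then have "calib c0 * calib c0 = (Complex c0 1 * Complex c0 1) / (Complex c0 1 * Complex c0 (-1))"
    unfolding calib_def * by simp
  then show ?thesis using nz by simp
qed

text \<open>The relation \<open>s^2 = 1 - c^2\<close> makes \<open>d\<close> factor out of
  \<open>u - 1\<close> exactly, so the later estimates are plain expansions in \<open>d\<close>. The
  denominator \<open>g\<close> has modulus at least 1, uniformly in \<open>c0\<close>.\<close>

lemma macro_basis:
  fixes c s c0 :: real
  assumes cs: "c\<^sup>2 + s\<^sup>2 = 1"
  defines "d \<equiv> of_real (c - c0) :: complex" and "g \<equiv> Complex c0 (-1)"
  defines "u \<equiv> 1 + \<i> * d * Complex c (-1) / g" and "l \<equiv> \<i> * of_real s * d / g"
  shows "macro c s c0 (1, 0) = (- u, - l)" "macro c s c0 (0, 1) = (- cnj l, cnj u)"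
proof -
  let ?b = "calib c0" and ?z = "cis (pi/4)"
  define C S h where "C = complex_of_real c" and "S = complex_of_real s" and "h = complex_of_real (sqrt 2 / 2)"
  define b b' where "b = ?b" and "b' = cnj ?b"
  have g: "g \<noteq> 0" "cnj g \<noteq> 0" by (auto simp: g_def complex_eq_iff)
  have hh: "h * h = 1/2"
    unfolding h_def by (simp flip: of_real_mult)
  have z: "of_real (Re ?z) = h" "of_real (Im ?z) = h"
    unfolding h_def by (simp_all add: cos_45 sin_45)
  have b2: "b * b = cnj g / g"
    using calib_sq[of c0] by (simp add: b_def g_def complex_cnj del: complex_cnj_divide)
  have b2': "b' * b' = g / cnj g"
    using arg_cong[OF b2, of cnj] by (simp add: b_def b'_def)
  have bb: "b * b' = 1"
    using calib_cnj by (simp add: b_def b'_def)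
  have SS: "S * S = 1 - C * C"
    using cs unfolding S_def C_def by (simp add: power2_eq_square flip: of_real_mult) (metis add_diff_cancel_left' of_real_1 of_real_diff)
  have gc: "g = of_real c0 - \<i>" "cnj g = of_real c0 + \<i>" "Complex c (-1) = C - \<i>"
    by (simp_all add: g_def C_def complex_eq_iff)
  have "macro c s c0 (1, 0) = (h * h * ((b * b) * (1 + \<i> * C)\<^sup>2 - b * b' * (S * S)),
      h * h * \<i> * S * (b * b * (1 + \<i> * C) + b * b' * (1 - \<i> * C)))"
    unfolding macro_def sig_rot_def phases_def z
    by (simp add: algebra_simps power2_eq_square b'_def b_def flip: C_def S_def)
  also have "\<dots> = (- u, - l)"
    unfolding hh b2 bb SS u_def l_def gc(3) d_def of_real_diff C_def[symmetric] S_def[symmetric]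
    using g unfolding gc
    by (simp add: field_simps power2_eq_square)
  finally show "macro c s c0 (1, 0) = (- u, - l)" .
  have "macro c s c0 (0, 1) = (h * h * (- (\<i> * S)) * (b * b' * (1 + \<i> * C) + b' * b' * (1 - \<i> * C)),
      h * h * (b * b' * (S * S) - b' * b' * (1 - \<i> * C)\<^sup>2))"
    unfolding macro_def sig_rot_def phases_def z
    by (simp add: algebra_simps power2_eq_square b'_def b_def flip: C_def S_def)
  also have "\<dots> = (- cnj l, cnj u)"
  proof -
    have cc: "cnj u = 1 + (- \<i>) * (C - of_real c0) * (C + \<i>) / cnj g" 
      "cnj l = (- \<i>) * S * (C - of_real c0) / cnj g"
      unfolding u_def l_def gc(3) d_def C_def S_def by simp_all
    define G where "G = cnj g"
    have G: "G \<noteq> 0" "complex_of_real c0 = G - \<i>" "g = G - 2 * \<i>"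
      using g(2) gc(1,2) by (simp_all add: G_def)
    show ?thesis
      unfolding hh b2' bb SS cc G_def[symmetric] unfolding G(2,3)
      using G(1) by (simp add: field_simps power2_eq_square)
  qed
  finally show "macro c s c0 (0, 1) = (- cnj l, cnj u)" .
qed

lemma cis_approx: "cmod (cis x - (1 + \<i> * of_real x)) \<le> x\<^sup>2"
proof -
  have 1: "\<bar>cos x - 1\<bar> \<le> x\<^sup>2 / 2"
  proof -
    have "\<bar>sin (x / 2)\<bar>\<^sup>2 \<le> \<bar>x / 2\<bar>\<^sup>2"
      using abs_sin_x_le_abs_x[of "x / 2"] by (intro power_mono) auto
    moreover have "cos x = 1 - 2 * (sin (x / 2))\<^sup>2"
      using cos_double_sin[of "x / 2"] by simp
    ultimately show ?thesis by (simp add: power_divide)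
  qed
  have 2: "\<bar>sin x - x\<bar> \<le> x\<^sup>2 / 2"
    using Maclaurin_sin_bound[of x 2] by (simp add: numeral_2_eq_2 sin_coeff_def)
  have "cmod (cis x - (1 + \<i> * of_real x)) \<le> \<bar>cos x - 1\<bar> + \<bar>sin x - x\<bar>"
    using cmod_le[of "cis x - (1 + \<i> * of_real x)"] by simp
  with 1 2 show ?thesis by simp
qed

text \<open>Unitarity, \<open>|u|^2 + |l|^2 = 1\<close>, turns the diagonal entry
  \<open>u^2 + |l|^2\<close> into \<open>1 + 2 i u Im u\<close>. Since \<open>u = 1 + O(d)\<close>
  and \<open>Im u = d + O(d^2)\<close>, this agrees with \<open>cis (2 * d)\<close> to second order;
  the leakage \<open>l * (u - cnj u)\<close> is a product of two first-order terms.\<close>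

lemma macro_twice:
  fixes c s c0 :: real
  assumes cs: "c\<^sup>2 + s\<^sup>2 = 1"
  defines "d \<equiv> c - c0"
  shows "norm (macro c s c0 (macro c s c0 (1, 0)) - phases (cis (2 * d)) (cis (2 * d)) (1, 0))
     \<le> 14 * d\<^sup>2"
proof -
  define g where "g = Complex c0 (-1)"
  define r where "r = \<i> * of_real d * Complex c (-1) / g"
  define u where "u = 1 + r"
  define l where "l = \<i> * of_real s * of_real d / g"
  define v where "v = Im u"
  have lin: "linear_isometry (macro c s c0)" using cs by (rule linear_isometry_macro)
  have split: "(x, y) = phases x x (1, 0) - phases (- y) (- y) (0, 1)" for x y
    by (simp add: phases_def)
  have "macro c s c0 (macro c s c0 (1, 0)) = macro c s c0 (- u, - l)"
    using macro_basis(1)[OF cs, of c0] unfolding u_def r_def l_def g_def d_def by simp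
  also have "\<dots> = phases (- u) (- u) (- u, - l) - phases l l (- cnj l, cnj u)"
  proof -
    have "macro c s c0 (- u, - l) = phases (- u) (- u) (macro c s c0 (1, 0))
        - phases l l (macro c s c0 (0, 1))"
      by (simp add: split[of "- u" "- l"] linear_isometryD(1,2)[OF lin])
    then show ?thesis
      using macro_basis[OF cs, of c0] unfolding u_def r_def l_def g_def d_def
      by (simp add: algebra_simps)
  qed
  also have "\<dots> = (u * u + l * cnj l, l * (u - cnj u))"
    by (simp add: phases_def algebra_simps)
  finally have M: "macro c s c0 (macro c s c0 (1, 0)) = (u * u + l * cnj l, l * (u - cnj u))" .
  have g2: "(cmod g)\<^sup>2 = 1 + c0\<^sup>2" "g \<noteq> 0"
    by (simp_all add: cmod_power2 g_def complex_eq_iff)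
  have g1: "1 \<le> cmod g"
    using abs_Im_le_cmod[of g] by (simp add: g_def)
  have s1: "\<bar>s\<bar> \<le> 1" and c1: "\<bar>c\<bar> \<le> 1"
    using cs zero_le_power2[of s] zero_le_power2[of c]
    unfolding abs_square_le_1[symmetric] by linarith+
  have "norm (macro c s c0 (1, 0)) = norm ((1, 0) :: complex \<times> complex)"
    by (rule linear_isometryD[OF lin])
  then have "norm (- u, - l) = 1"
    using macro_basis(1)[OF cs, of c0] unfolding u_def r_def l_def g_def d_def by simp
  then have "(cmod u)\<^sup>2 + (cmod l)\<^sup>2 = 1"
    by (simp add: norm_prod_def)
  moreover have "u * cnj u + l * cnj l = of_real ((cmod u)\<^sup>2 + (cmod l)\<^sup>2)"
    by (simp only: complex_norm_square of_real_add)
  ultimately have ul: "u * cnj u + l * cnj l = 1"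
    by simp
  have uu: "u * u + l * cnj l = 1 + 2 * \<i> * u * of_real v"
  proof -
    have "u - cnj u = 2 * \<i> * of_real v"
      by (simp add: v_def complex_eq_iff)
    then have "u * u - u * cnj u = 2 * \<i> * u * of_real v"
      by (metis mult.assoc mult.commute right_diff_distrib)
    with ul show ?thesis by (simp add: algebra_simps)
  qed
  have r_le: "cmod r \<le> 3/2 * \<bar>d\<bar>"
  proof -
    \<comment> \<open>3/2 is a rational bound for the square root of 2, the modulus at
      \<open>|c| = 1\<close>.\<close>
    have "cmod (Complex c (-1)) \<le> 3/2"
    proof (rule power2_le_imp_le)
      show "(cmod (Complex c (-1)))\<^sup>2 \<le> (3/2)\<^sup>2"
      proof -
        have "c\<^sup>2 \<le> 1" using cs zero_le_power2[of s] by linarith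
        then show ?thesis by (simp add: cmod_power2 power_divide)
      qed
    qed simp
    then have "cmod r \<le> \<bar>d\<bar> * (3/2) / 1"
      unfolding r_def norm_mult norm_divide using g1
      by (intro frac_le mult_mono) auto
    then show ?thesis by simp
  qed
  have v_le: "\<bar>v\<bar> \<le> 3/2 * \<bar>d\<bar>"
    using r_le abs_Im_le_cmod[of r] by (simp add: v_def u_def)
  have v_near: "\<bar>v - d\<bar> \<le> d\<^sup>2"
  proof -
    have "Complex c (-1) = g + of_real d"
      by (simp add: g_def d_def complex_eq_iff)
    then have "r - \<i> * of_real d = \<i> * of_real d * of_real d / g"
      unfolding r_def using g2(2) by (simp add: field_simps)
    then have "cmod (r - \<i> * of_real d) = d\<^sup>2 / cmod g"
      by (simp add: norm_mult norm_divide power2_eq_square flip: abs_mult)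
    also have "\<dots> \<le> d\<^sup>2 / 1"
      using g1 by (intro divide_left_mono) auto
    finally have "cmod (r - \<i> * of_real d) \<le> d\<^sup>2" by simp
    then show ?thesis
      using abs_Im_le_cmod[of "r - \<i> * of_real d"] by (simp add: v_def u_def)
  qed
  have l_le: "cmod l \<le> \<bar>d\<bar>"
  proof -
    have "cmod l \<le> 1 * \<bar>d\<bar> / 1"
      unfolding l_def norm_mult norm_divide using g1 s1 by (intro frac_le mult_mono) auto
    then show ?thesis by simp
  qed
  have dd: "\<bar>d\<bar> * \<bar>d\<bar> = d\<^sup>2" by (simp add: power2_eq_square)
  have rv: "cmod r * \<bar>v\<bar> \<le> 9/4 * d\<^sup>2"
    using mult_mono[OF r_le v_le] dd by simp
  have lv: "cmod l * \<bar>v\<bar> \<le> 3/2 * d\<^sup>2"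
    using mult_mono[OF l_le v_le] dd by simp
  have "cmod (u * u + l * cnj l - cis (2 * d)) \<le> 2 * \<bar>v - d\<bar> + 2 * (cmod r * \<bar>v\<bar>) + (2 * d)\<^sup>2"
  proof -
    have "u * u + l * cnj l - cis (2 * d)
       = 2 * \<i> * of_real (v - d) + 2 * \<i> * (r * of_real v) - (cis (2 * d) - (1 + \<i> * of_real (2 * d)))"
      unfolding uu unfolding u_def by (simp add: algebra_simps)
    also have "cmod \<dots> \<le> cmod (2 * \<i> * of_real (v - d)) + cmod (2 * \<i> * (r * of_real v))
        + cmod (cis (2 * d) - (1 + \<i> * of_real (2 * d)))"
      by (rule order_trans[OF norm_triangle_ineq4 add_right_mono[OF norm_triangle_ineq]])
    also have "\<dots> \<le> 2 * \<bar>v - d\<bar> + 2 * (cmod r * \<bar>v\<bar>) + (2 * d)\<^sup>2"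
      using cis_approx[of "2 * d"] by (simp add: norm_mult del: of_real_diff)
    finally show ?thesis .
  qed
  also have "\<dots> \<le> 2 * d\<^sup>2 + 9/2 * d\<^sup>2 + 4 * d\<^sup>2"
    using v_near rv by (simp add: power_mult_distrib)
  finally have A: "cmod (u * u + l * cnj l - cis (2 * d)) \<le> 21/2 * d\<^sup>2" by simp
  have B: "cmod (l * (u - cnj u)) \<le> 3 * d\<^sup>2"
  proof -
    have "u - cnj u = 2 * \<i> * of_real v"
      by (simp add: v_def complex_eq_iff)
    then show ?thesis using lv by (simp add: norm_mult)
  qed
  have "norm (u * u + l * cnj l - cis (2 * d), l * (u - cnj u)) \<le> 21/2 * d\<^sup>2 + 3 * d\<^sup>2"
    by (rule order_trans[OF norm_Pair_le add_mono[OF A B]])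
  also have "\<dots> \<le> 14 * d\<^sup>2" by simp
  finally show ?thesis
    unfolding M phases_def by simp
qed

section \<open>Iterated gadgets and the parity signal\<close>

lemma norm_fst_le_norm: "norm (fst v) \<le> norm v"
  by (metis norm_fst_le prod.collapse)

text \<open>The gadgets are grouped in pairs because a single one flips the sign and leaks at first
  order. The modulus bound allows \<open>p\<close>-th powers to be compared at the price of a factor
  \<open>p\<close> only.\<close>

lemma macro_funpow:
  assumes cs: "c\<^sup>2 + s\<^sup>2 = 1"
  shows "cmod (fst ((macro c s c0 ^^ (2 * m)) (1, 0)) - cis (2 * real m * (c - c0)))
      \<le> 14 * real m * (c - c0)\<^sup>2"
    and "cmod (fst ((macro c s c0 ^^ (2 * m)) (1, 0))) \<le> 1"
proof -
  let ?M = "macro c s c0" and ?T = "\<lambda>v. macro c s c0 (macro c s c0 v)" and ?z = "cis (2 * (c - c0))"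
  have lin: "linear_isometry ?M" using cs by (rule linear_isometry_macro)
  have T: "linear_isometry ?T" using lin lin by (rule linear_isometry_comp)
  have eq: "?M ^^ (2 * m) = ?T ^^ m"
  proof -
    have "?M ^^ (2 * m) = (?M ^^ 2) ^^ m" by (simp only: funpow_mult mult.commute)
    also have "?M ^^ 2 = ?T" by (simp add: numeral_2_eq_2 comp_def)
    finally show ?thesis .
  qed
  have "norm ((?T ^^ m) (1, 0) - phases (?z ^ m) (?z ^ m) (1, 0)) \<le> real m * (14 * (c - c0)\<^sup>2)"
    using T macro_twice[OF cs] by (intro linear_isometry_funpow_near_phase) auto
  then have "cmod (fst ((?T ^^ m) (1, 0) - phases (?z ^ m) (?z ^ m) (1, 0))) \<le> real m * (14 * (c - c0)\<^sup>2)"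
    by (rule order_trans[OF norm_fst_le_norm])
  then show "cmod (fst ((?M ^^ (2 * m)) (1, 0)) - cis (2 * real m * (c - c0))) \<le> 14 * real m * (c - c0)\<^sup>2"
    unfolding eq by (simp add: phases_def DeMoivre mult_ac)
  have "norm ((?M ^^ (2 * m)) (1, 0)) = 1"
    using norm_linear_isometry_funpow[OF lin] by simp
  then show "cmod (fst ((?M ^^ (2 * m)) (1, 0))) \<le> 1"
    using norm_fst_le_norm[of "(?M ^^ (2 * m)) (1, 0)"] by simp
qed

lemma macro_signal:
  fixes c s c0 :: real and m p :: nat
  assumes cs: "c\<^sup>2 + s\<^sup>2 = 1"
  defines "K \<equiv> 2 * real m * real p"
  shows "\<bar>Im (fst ((macro c s c0 ^^ (2 * m)) (1, 0)) ^ p) - sin (K * (c - c0))\<bar>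
      \<le> 7 * K * (c - c0)\<^sup>2"
proof -
  let ?x = "fst ((macro c s c0 ^^ (2 * m)) (1, 0))" and ?z = "cis (2 * real m * (c - c0))"
  have "cmod (?x ^ p - ?z ^ p) \<le> real p * cmod (?x - ?z)"
    using macro_funpow(2)[OF cs] by (intro norm_power_diff) auto
  also have "\<dots> \<le> real p * (14 * real m * (c - c0)\<^sup>2)"
    using macro_funpow(1)[OF cs] by (intro mult_left_mono) auto
  also have "\<dots> = 7 * K * (c - c0)\<^sup>2"
    by (simp add: K_def)
  finally have "\<bar>Im (?x ^ p - ?z ^ p)\<bar> \<le> 7 * K * (c - c0)\<^sup>2"
    by (rule order_trans[OF abs_Im_le_cmod])
  then show ?thesis
    by (simp add: DeMoivre K_def mult_ac)
qed

text \<open>The budget is 1/6 for the cubic remainder of the sine and 7/128 for the quadratic error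
  of the gadgets; \<open>128 \<le> K\<close> keeps the sum below 1/4.\<close>

lemma macro_signal_linear:
  fixes c s c0 K :: real and m p :: nat
  assumes cs: "c\<^sup>2 + s\<^sup>2 = 1" and K: "K = 2 * real m * real p" "128 \<le> K"
    and near: "\<bar>c - c0\<bar> \<le> 1 / K"
  shows "\<bar>Im (fst ((macro c s c0 ^^ (2 * m)) (1, 0)) ^ p) - K * (c - c0)\<bar> \<le> 1 / 4"
proof -
  let ?y = "K * (c - c0)"
  have "0 < K" using K(2) by simp
  then have y: "\<bar>?y\<bar> \<le> 1"
    using mult_left_mono[OF near, of K] unfolding abs_mult by simp
  have "\<bar>sin ?y - ?y\<bar> \<le> inverse (fact 3) * \<bar>?y\<bar> ^ 3"
    using Maclaurin_sin_bound[of ?y 3] by (simp add: numeral_3_eq_3 sin_coeff_def)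
  also have "\<dots> \<le> 1 / 6 * 1"
    using y power_le_one[of "\<bar>?y\<bar>" 3] by (intro mult_mono) (auto simp: fact_numeral)
  finally have 1: "\<bar>sin ?y - ?y\<bar> \<le> 1 / 6" by simp
  have "7 * K * (c - c0)\<^sup>2 = 7 * \<bar>?y\<bar> * \<bar>c - c0\<bar>"
  proof -
    have "\<bar>?y\<bar> * \<bar>c - c0\<bar> = K * \<bar>c - c0\<bar>\<^sup>2"
      unfolding abs_mult power2_eq_square using \<open>0 < K\<close> by simp
    then show ?thesis by simp
  qed
  also have "\<dots> \<le> 7 * 1 * (1 / 128)"
  proof -
    have "1 / K \<le> 1 / 128" using K(2) by (intro divide_left_mono) auto
    then show ?thesis using y near by (intro mult_mono) auto
  qed
  finally have "7 * K * (c - c0)\<^sup>2 \<le> 7 / 128" by simp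
  then show ?thesis
    using 1 macro_signal[OF cs, where ?c0.0 = c0 and m = m and p = p] unfolding K(1)[symmetric] by linarith
qed

section \<open>Unitary gates and circuits\<close>

lemma is_unitaryD:
  assumes "is_unitary d M"
  shows "M \<in> carrier_mat d d" "cadj M \<in> carrier_mat d d" "M * cadj M = 1\<^sub>m d" "cadj M * M = 1\<^sub>m d"
  using assms by (auto simp: is_unitary_def cadj_def)

lemma cadj_carrier: "M \<in> carrier_mat d e \<Longrightarrow> cadj M \<in> carrier_mat e d"
  by (auto simp: cadj_def)

lemma cadj_cadj: "cadj (cadj M) = M"
  by (rule eq_matI) (auto simp: cadj_def)

lemma is_unitary_cadj: "is_unitary d M \<Longrightarrow> is_unitary d (cadj M)"
  by (auto simp: is_unitary_def cadj_cadj cadj_carrier)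

lemma is_unitary_mat_diag:
  assumes "\<And>i. i < d \<Longrightarrow> cmod (f i) = 1"
  shows "is_unitary d (mat_diag d f)"
proof -
  have c: "cadj (mat_diag d f) = mat_diag d (\<lambda>i. cnj (f i))"
    by (rule eq_matI) (auto simp: cadj_def mat_diag_def)
  have "mat_diag d (\<lambda>i. f i * cnj (f i)) = 1\<^sub>m d"
    using assms by (intro eq_matI) (auto simp: mat_diag_def simp flip: complex_norm_square)
  then show ?thesis
    unfolding is_unitary_def c by (simp add: mult.commute)
qed

lemma mat_diag_mult_vec:
  "v \<in> carrier_vec d \<Longrightarrow> mat_diag d f *\<^sub>v v = vec d (\<lambda>i. f i * v $ i)"
  by (rule eq_vecI) (auto simp: mat_diag_def scalar_prod_def if_distrib if_distribR sum.delta cong: if_cong)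

lemma cadj_four_block:
  assumes "A \<in> carrier_mat d d" "B \<in> carrier_mat d d" "C \<in> carrier_mat d d" "D \<in> carrier_mat d d"
  shows "cadj (four_block_mat A B C D) = four_block_mat (cadj A) (cadj C) (cadj B) (cadj D)"
  using assms by (intro eq_matI) (auto simp: cadj_def)

lemma cadj_zero_mat [simp]: "cadj (0\<^sub>m d e) = 0\<^sub>m e d"
  by (rule eq_matI) (auto simp: cadj_def)

lemma cadj_one_mat [simp]: "cadj (1\<^sub>m d) = 1\<^sub>m d"
  by (rule eq_matI) (auto simp: cadj_def)

lemma is_unitary_block_diag:
  assumes "is_unitary d A" "is_unitary d B"
  shows "is_unitary (d + d) (four_block_mat A (0\<^sub>m d d) (0\<^sub>m d d) B)"
proof -
  note A = is_unitaryD[OF assms(1)] and B = is_unitaryD[OF assms(2)]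
  show ?thesis
    unfolding is_unitary_def
    using A B by (simp add: cadj_four_block[of _ d] mult_four_block_mat[of _ d d _ d _ d _ _ d _ d]
      left_mult_zero_mat[of _ d d d] right_mult_zero_mat[of _ d d d])
qed

text \<open>The Hadamard gate on the ancilla. The ancilla is the most significant bit, so the two
  halves of a vector are its two ancilla branches.\<close>

definition had :: "nat \<Rightarrow> complex mat" where
  "had d = (let h = (1 / of_real (sqrt 2)) \<cdot>\<^sub>m 1\<^sub>m d in four_block_mat h h h (- h))"

lemma is_unitary_had: "is_unitary (d + d) (had d)"
proof -
  define r where "r = 1 / complex_of_real (sqrt 2)"
  let ?h = "r \<cdot>\<^sub>m 1\<^sub>m d :: complex mat"
  have r2: "r * r = 1/2" unfolding r_def by (simp flip: of_real_mult)
  have r: "cnj r = r" by (simp add: r_def)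
  have h: "cadj ?h = ?h" "cadj (- ?h) = - ?h"
    by (rule eq_matI; auto simp: cadj_def r)+
  have hh: "?h * ?h = (1/2) \<cdot>\<^sub>m 1\<^sub>m d" "?h * (- ?h) = - (1/2) \<cdot>\<^sub>m 1\<^sub>m d" 
    "(- ?h) * ?h = - (1/2) \<cdot>\<^sub>m 1\<^sub>m d" "(- ?h) * (- ?h) = (1/2) \<cdot>\<^sub>m 1\<^sub>m d"
    by (rule eq_matI; auto simp: r2)+
  have ss: "(1/2) \<cdot>\<^sub>m 1\<^sub>m d + (1/2) \<cdot>\<^sub>m 1\<^sub>m d = (1\<^sub>m d :: complex mat)"
    "(1/2) \<cdot>\<^sub>m 1\<^sub>m d + - (1/2) \<cdot>\<^sub>m 1\<^sub>m d = (0\<^sub>m d d :: complex mat)"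
    by (rule eq_matI; auto)+
  have "four_block_mat ?h ?h ?h (- ?h) * four_block_mat ?h ?h ?h (- ?h) = 1\<^sub>m (d + d)"
    by (subst mult_four_block_mat[of _ d d _ d _ d _ _ d _ d]) (simp_all add: hh ss)
  then show ?thesis
    unfolding is_unitary_def had_def Let_def r_def[symmetric]
    by (simp add: cadj_four_block[of _ d] h)
qed

lemma had_mult_vec:
  assumes "v \<in> carrier_vec d" "w \<in> carrier_vec d"
  shows "had d *\<^sub>v (v @\<^sub>v w) = (1 / of_real (sqrt 2)) \<cdot>\<^sub>v (v + w) @\<^sub>v (1 / of_real (sqrt 2)) \<cdot>\<^sub>v (v - w)"
proof -
  let ?r = "1 / complex_of_real (sqrt 2)"
  have "(?r \<cdot>\<^sub>m 1\<^sub>m d) *\<^sub>v u = ?r \<cdot>\<^sub>v u" "(- (?r \<cdot>\<^sub>m 1\<^sub>m d)) *\<^sub>v u = - (?r \<cdot>\<^sub>v u)" if "u \<in> carrier_vec d" for u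
    using that by (intro eq_vecI; auto)+
  then have "had d *\<^sub>v (v @\<^sub>v w) = (?r \<cdot>\<^sub>v v + ?r \<cdot>\<^sub>v w) @\<^sub>v (?r \<cdot>\<^sub>v v + - (?r \<cdot>\<^sub>v w))"
    using assms unfolding had_def Let_def by (subst four_block_mat_mult_vec[of _ d d _ d _ d]) auto
  also have "?r \<cdot>\<^sub>v v + ?r \<cdot>\<^sub>v w = ?r \<cdot>\<^sub>v (v + w)"
    using assms by (intro eq_vecI) (auto simp: field_simps)
  also have "?r \<cdot>\<^sub>v v + - (?r \<cdot>\<^sub>v w) = ?r \<cdot>\<^sub>v (v - w)"
    using assms by (intro eq_vecI) (auto simp: field_simps)
  finally show ?thesis .
qed

lemma lift_reg_eq:
  assumes "M \<in> carrier_mat (2 ^ n) (2 ^ n)"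
  shows "lift_reg n M = four_block_mat M (0\<^sub>m (2 ^ n) (2 ^ n)) (0\<^sub>m (2 ^ n) (2 ^ n)) M"
proof -
  have dv: "i div 2 ^ n = (if i < 2 ^ n then 0 else 1)" "i mod 2 ^ n = (if i < 2 ^ n then i else i - 2 ^ n)"
    if "i < 2 ^ n + 2 ^ n" for i :: nat
    using that by (auto simp: div_if mod_if)
  show ?thesis
    using assms by (intro eq_matI) (auto simp: lift_reg_def dv)
qed

lemma block_diag_mult_vec:
  fixes A B :: "complex mat"
  assumes "A \<in> carrier_mat d d" "B \<in> carrier_mat d d" "v \<in> carrier_vec d" "w \<in> carrier_vec d"
  shows "four_block_mat A (0\<^sub>m d d) (0\<^sub>m d d) B *\<^sub>v (v @\<^sub>v w) = A *\<^sub>v v @\<^sub>v B *\<^sub>v w"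
proof -
  have z: "0\<^sub>m d d *\<^sub>v u = 0\<^sub>v d" if "u \<in> carrier_vec d" for u :: "complex vec"
    using that by (intro eq_vecI) auto
  show ?thesis
    unfolding four_block_mat_mult_vec[OF assms(1) zero_carrier_mat zero_carrier_mat assms(2-4)]
      z[OF assms(3)] z[OF assms(4)] using assms by simp
qed

lemma is_unitary_step_mat:
  assumes "is_unitary (2 ^ n) U" "\<And>G. s = Gate G \<Longrightarrow> is_unitary (2 ^ (n + 1)) G"
  shows "is_unitary (2 ^ (n + 1)) (step_mat n U s)"
proof (cases s)
  case (Gate G)
  then show ?thesis using assms by simp
next
  case (Query b)
  have "is_unitary (2 ^ n) (if b then cadj U else U)"
    using assms(1) by (simp add: is_unitary_cadj)
  from is_unitary_block_diag[OF this this] lift_reg_eq[OF is_unitaryD(1)[OF this]]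
  show ?thesis by (simp add: Query mult_2)
qed

section \<open>Hermitian inner products along a circuit\<close>

definition hdot :: "complex vec \<Rightarrow> complex vec \<Rightarrow> complex" where
  "hdot v w = (\<Sum>i<dim_vec v. v $ i * cnj (w $ i))"

lemma hdot_unitary:
  assumes "is_unitary d M" "v \<in> carrier_vec d" "w \<in> carrier_vec d"
  shows "hdot (M *\<^sub>v v) (M *\<^sub>v w) = hdot v w"
proof -
  note M = is_unitaryD[OF assms(1)]
  have orth: "(\<Sum>i<d. cnj (M $$ (i, k)) * M $$ (i, j)) = (if k = j then 1 else 0)" if "j < d" "k < d" for j k
  proof -
    have "(cadj M * M) $$ (k, j) = (\<Sum>i<d. cnj (M $$ (i, k)) * M $$ (i, j))"
      using M(1) that by (auto simp: scalar_prod_def cadj_def atLeast0LessThan)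
    then show ?thesis using that by (simp add: M(4))
  qed
  have Mv: "(M *\<^sub>v u) $ i = (\<Sum>j<d. M $$ (i, j) * u $ j)" if "i < d" "u \<in> carrier_vec d" for i u
    using M that by (auto simp: scalar_prod_def atLeast0LessThan)
  have "hdot (M *\<^sub>v v) (M *\<^sub>v w) = (\<Sum>i<d. \<Sum>j<d. \<Sum>k<d. v $ j * cnj (w $ k) * (cnj (M $$ (i, k)) * M $$ (i, j)))"
    using M assms(2,3) by (simp add: hdot_def Mv sum_product mult_ac del: index_mult_mat_vec)
  also have "\<dots> = (\<Sum>j<d. \<Sum>i<d. \<Sum>k<d. v $ j * cnj (w $ k) * (cnj (M $$ (i, k)) * M $$ (i, j)))"
    by (rule sum.swap)
  also have "\<dots> = (\<Sum>j<d. \<Sum>k<d. \<Sum>i<d. v $ j * cnj (w $ k) * (cnj (M $$ (i, k)) * M $$ (i, j)))"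
    by (intro sum.cong refl sum.swap)
  also have "\<dots> = (\<Sum>j<d. \<Sum>k<d. v $ j * cnj (w $ k) * (if k = j then 1 else 0))"
    by (intro sum.cong refl) (simp add: orth flip: sum_distrib_left)
  also have "\<dots> = hdot v w"
  proof -
    have "(\<Sum>k<d. v $ j * cnj (w $ k) * (if k = j then 1 else 0)) = v $ j * cnj (w $ j)" if "j < d" for j
      using that by (simp add: if_distrib[of "\<lambda>x. _ * x"] cong: if_cong)
    then show ?thesis using assms(2) by (simp add: hdot_def)
  qed
  finally show ?thesis .
qed

lemma run_circ_Nil [simp]: "run_circ n U [] v = v"
  and run_circ_Cons [simp]: "run_circ n U (s # cs) v = run_circ n U cs (step_mat n U s *\<^sub>v v)"
  and run_circ_append: "run_circ n U (cs @ ds) v = run_circ n U ds (run_circ n U cs v)"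
  by (simp_all add: run_circ_def)

lemma run_circ_unitary:
  assumes "is_unitary (2 ^ n) U" "\<And>G. Gate G \<in> set cs \<Longrightarrow> is_unitary (2 ^ (n + 1)) G"
    and "v \<in> carrier_vec (2 ^ (n + 1))" "w \<in> carrier_vec (2 ^ (n + 1))"
  shows "run_circ n U cs v \<in> carrier_vec (2 ^ (n + 1))"
    and "hdot (run_circ n U cs v) (run_circ n U cs w) = hdot v w"
proof -
  have "run_circ n U cs v \<in> carrier_vec (2 ^ (n + 1)) \<and> hdot (run_circ n U cs v) (run_circ n U cs w) = hdot v w"
    using assms(2-)
  proof (induction cs arbitrary: v w)
    case (Cons s cs)
    have s: "is_unitary (2 ^ (n + 1)) (step_mat n U s)"
      using Cons.prems(1) by (intro is_unitary_step_mat assms(1)) auto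
    then show ?case
      using Cons.IH[of "step_mat n U s *\<^sub>v v" "step_mat n U s *\<^sub>v w"] Cons.prems
        hdot_unitary[OF s] mult_mat_vec_carrier[OF is_unitaryD(1)[OF s]] by simp
  qed simp
  then show "run_circ n U cs v \<in> carrier_vec (2 ^ (n + 1))"
    and "hdot (run_circ n U cs v) (run_circ n U cs w) = hdot v w" by auto
qed

section \<open>Action on the register\<close>

text \<open>For \<open>z = cis t\<close> this is \<open>exp (i t Z)\<close> on the flag, which is
  the least significant bit and hence the parity of the index.\<close>

definition flag_phase :: "nat \<Rightarrow> complex \<Rightarrow> complex mat" where
  "flag_phase n z = mat_diag (2 ^ n) (\<lambda>i. if even i then z else cnj z)"

definition init_phase :: "nat \<Rightarrow> complex \<Rightarrow> complex \<Rightarrow> complex mat" where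
  "init_phase n z1 z2 = mat_diag (2 ^ n) (\<lambda>i. if i = 0 then z1 else z2)"

definition flag_reflect :: "nat \<Rightarrow> complex mat \<Rightarrow> complex vec \<Rightarrow> complex vec" where
  "flag_reflect n U v = cadj U *\<^sub>v (mat_diag (2 ^ n) (\<lambda>i. if even i then 1 else - 1) *\<^sub>v (U *\<^sub>v v))"

text \<open>For \<^term>\<open>s = 0\<close> the flag reflection fixes the initial vector up to sign, and division by zero
  makes the leak vector \<^term>\<open>0\<close>, which is consistent with the coordinates of \<open>reg_vec\<close> below.\<close>
definition leak_vec :: "nat \<Rightarrow> real \<Rightarrow> real \<Rightarrow> complex mat \<Rightarrow> complex vec" where
  "leak_vec n c s U =
     of_real (1 / s) \<cdot>\<^sub>v (flag_reflect n U (unit_vec (2 ^ n) 0) - of_real c \<cdot>\<^sub>v unit_vec (2 ^ n) 0)"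

definition reg_vec :: "nat \<Rightarrow> real \<Rightarrow> real \<Rightarrow> complex mat \<Rightarrow> complex \<times> complex \<Rightarrow> complex vec" where
  "reg_vec n c s U v = fst v \<cdot>\<^sub>v unit_vec (2 ^ n) 0 + snd v \<cdot>\<^sub>v leak_vec n c s U"

lemma is_unitary_flag_phase: "cmod z = 1 \<Longrightarrow> is_unitary (2 ^ n) (flag_phase n z)"
  unfolding flag_phase_def by (rule is_unitary_mat_diag) auto

lemma is_unitary_init_phase: "cmod z1 = 1 \<Longrightarrow> cmod z2 = 1 \<Longrightarrow> is_unitary (2 ^ n) (init_phase n z1 z2)"
  unfolding init_phase_def by (rule is_unitary_mat_diag) auto

lemma hdot_self: "hdot v v = of_real (\<Sum>i<dim_vec v. (cmod (v $ i))\<^sup>2)"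
  by (simp add: hdot_def flip: complex_norm_square)

lemma mult_mat_vec_lincomb:
  fixes M :: "'a :: field mat"
  assumes "M \<in> carrier_mat d e" "v \<in> carrier_vec e" "w \<in> carrier_vec e"
  shows "M *\<^sub>v (x \<cdot>\<^sub>v v + y \<cdot>\<^sub>v w) = x \<cdot>\<^sub>v (M *\<^sub>v v) + y \<cdot>\<^sub>v (M *\<^sub>v w)"
  using assms by (simp add: mult_add_distrib_mat_vec[of _ d e] mult_mat_vec[of _ d e])

lemma sum_even_odd:
  fixes f :: "nat \<Rightarrow> 'a :: comm_monoid_add"
  shows "(\<Sum>i<2 * m. f i) = (\<Sum>k<m. f (2 * k)) + (\<Sum>k<m. f (2 * k + 1))"
  by (induction m) (simp_all add: ac_simps)

context
  fixes n :: nat and a c s :: real and U :: "complex mat"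
  assumes n: "1 \<le> n" and a: "0 \<le> a" "a \<le> 1" and U: "amp_oracle n a U"
  defines "c \<equiv> 1 - 2 * a" and "s \<equiv> sqrt (1 - c\<^sup>2)"
begin

abbreviation (input) "e0 \<equiv> unit_vec (2 ^ n) 0 :: complex vec"
abbreviation (input) "W \<equiv> flag_reflect n U"

lemma oracle_unitary: "is_unitary (2 ^ n) U"
  using U by (simp add: amp_oracle_def)

lemma bias_sq: "c\<^sup>2 + s\<^sup>2 = 1"
proof -
  have "c\<^sup>2 \<le> 1" using a unfolding c_def abs_square_le_1 by simp
  then show ?thesis by (simp add: s_def)
qed

lemma step_carriers [simp]:
  assumes "v \<in> carrier_vec (2 ^ n)"
  shows "U *\<^sub>v v \<in> carrier_vec (2 ^ n)" "cadj U *\<^sub>v v \<in> carrier_vec (2 ^ n)"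
    "mat_diag (2 ^ n) f *\<^sub>v v \<in> carrier_vec (2 ^ n)"
  by (rule mult_mat_vec_carrier[OF _ assms]; simp add: is_unitaryD[OF oracle_unitary])+

lemma flag_reflect_carrier: "v \<in> carrier_vec (2 ^ n) \<Longrightarrow> W v \<in> carrier_vec (2 ^ n)"
  by (simp add: flag_reflect_def)

lemma flag_reflect_lincomb:
  assumes "v \<in> carrier_vec (2 ^ n)" "w \<in> carrier_vec (2 ^ n)"
  shows "W (x \<cdot>\<^sub>v v + y \<cdot>\<^sub>v w) = x \<cdot>\<^sub>v W v + y \<cdot>\<^sub>v W w"
  using assms unfolding flag_reflect_def
  by (simp add: mult_mat_vec_lincomb[OF is_unitaryD(1)[OF oracle_unitary]] mult_mat_vec_lincomb[OF is_unitaryD(2)[OF oracle_unitary]]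
      mult_mat_vec_lincomb[OF mat_diag_dim])

lemma cadj_U_U:
  assumes "v \<in> carrier_vec (2 ^ n)"
  shows "cadj U *\<^sub>v (U *\<^sub>v v) = v" "U *\<^sub>v (cadj U *\<^sub>v v) = v"
  using is_unitaryD[OF oracle_unitary] assms by (simp_all flip: assoc_mult_mat_vec)

lemma flag_reflect_involution:
  assumes "v \<in> carrier_vec (2 ^ n)"
  shows "W (W v) = v"
proof -
  let ?Z = "mat_diag (2 ^ n) (\<lambda>i. if even i then 1 else - 1 :: complex)"
  have "?Z *\<^sub>v (?Z *\<^sub>v u) = u" if "u \<in> carrier_vec (2 ^ n)" for u
    using that by (intro eq_vecI) (auto simp: mat_diag_mult_vec)
  then show ?thesis
    using assms by (simp add: flag_reflect_def cadj_U_U)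
qed

text \<open>Transported through \<open>U\<close>, the inner product with the initial vector becomes
  the expectation of \<open>Z\<close> on the flag: probability \<open>1 - a\<close> of even indices
  minus probability \<open>a\<close> of odd ones.\<close>

lemma flag_reflect_init: "W e0 $ 0 = of_real c"
proof -
  let ?Z = "mat_diag (2 ^ n) (\<lambda>i. if even i then 1 else - 1 :: complex)"
  let ?u = "U *\<^sub>v e0"
  obtain \<psi>0 \<psi>1 where st: "is_state (n - 1) \<psi>0" "is_state (n - 1) \<psi>1"
    and u: "?u = vec (2 ^ n) (\<lambda>i. if even i then complex_of_real (sqrt (1 - a)) * \<psi>0 $ (i div 2)
                                    else complex_of_real (sqrt a) * \<psi>1 $ (i div 2))"
    using U unfolding amp_oracle_def by blast
  have uc: "?u \<in> carrier_vec (2 ^ n)" by (simp add: u)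
  have e0: "e0 \<in> carrier_vec (2 ^ n)" by simp
  have "W e0 $ 0 = hdot (W e0) e0"
    using flag_reflect_carrier[OF e0] by (simp add: hdot_def if_distrib cong: if_cong)
  also have "\<dots> = hdot (U *\<^sub>v W e0) (U *\<^sub>v e0)"
    using hdot_unitary[OF oracle_unitary flag_reflect_carrier[OF e0] e0] by simp
  also have "U *\<^sub>v W e0 = ?Z *\<^sub>v ?u"
    unfolding flag_reflect_def by (intro cadj_U_U) simp
  also have "hdot (?Z *\<^sub>v ?u) ?u = of_real (\<Sum>i<2 ^ n. (if even i then 1 else - 1) * (cmod (?u $ i))\<^sup>2)"
    using uc by (auto simp: mat_diag_mult_vec hdot_def mult.assoc simp del: index_mult_mat_vec
        simp flip: complex_norm_square intro!: sum.cong)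
  also have "(\<Sum>i<2 ^ n. (if even i then 1 else - 1) * (cmod (?u $ i))\<^sup>2)
     = (\<Sum>k<2 ^ (n - 1). (1 - a) * (cmod (\<psi>0 $ k))\<^sup>2) - (\<Sum>k<2 ^ (n - 1). a * (cmod (\<psi>1 $ k))\<^sup>2)"
  proof -
    have idx: "2 * k < 2 ^ n" "Suc (2 * k) < 2 ^ n" if "k < 2 ^ (n - 1)" for k
      using that n by (cases n; simp)+
    have "(\<Sum>i<2 ^ n. (if even i then 1 else - 1) * (cmod (?u $ i))\<^sup>2)
        = (\<Sum>i<2 * 2 ^ (n - 1). (if even i then 1 else - 1) * (cmod (?u $ i))\<^sup>2)"
      using n by (intro sum.cong) (simp_all flip: power_Suc)
    also have "\<dots> = (\<Sum>k<2 ^ (n - 1). (1 - a) * (cmod (\<psi>0 $ k))\<^sup>2) - (\<Sum>k<2 ^ (n - 1). a * (cmod (\<psi>1 $ k))\<^sup>2)"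
      using a by (simp only: sum_even_odd) (simp add: u idx[simplified] norm_mult power_mult_distrib sum_negf)
    finally show ?thesis .
  qed
  also have "\<dots> = c"
    using st by (simp add: is_state_def c_def flip: sum_distrib_left)
  finally show ?thesis .
qed

lemma leak_vec_carrier: "leak_vec n c s U \<in> carrier_vec (2 ^ n)"
  using flag_reflect_carrier by (simp add: leak_vec_def)

lemma reg_vec_carrier: "reg_vec n c s U v \<in> carrier_vec (2 ^ n)"
  using leak_vec_carrier by (simp add: reg_vec_def)

lemma leak_vec_0: "leak_vec n c s U $ 0 = 0"
  using flag_reflect_carrier[of e0] flag_reflect_init by (simp add: leak_vec_def)

text \<open>Scores read only the amplitude at index 0; this identity carries the two-dimensional
  estimates over to measurement statistics.\<close>

lemma reg_vec_0: "reg_vec n c s U v $ 0 = fst v"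
  using leak_vec_carrier leak_vec_0 by (simp add: reg_vec_def)

lemma reg_vec_init: "reg_vec n c s U (1, 0) = e0"
  using leak_vec_carrier by (intro eq_vecI) (auto simp: reg_vec_def)

lemma flag_reflect_e0: "W e0 = of_real c \<cdot>\<^sub>v e0 + of_real s \<cdot>\<^sub>v leak_vec n c s U"
proof (cases "s = 0")
  case False
  then show ?thesis
    using flag_reflect_carrier[of e0] by (intro eq_vecI) (auto simp: leak_vec_def)
next
  case True
  \<comment> \<open>Here \<open>|c| = 1\<close>, so the coordinate at index 0 exhausts the norm of
    the unit vector \<open>W e0\<close> and all others vanish.\<close>
  then have c2: "c\<^sup>2 = 1" using bias_sq by simp
  have e0: "e0 \<in> carrier_vec (2 ^ n)" by simp
  have "hdot (W e0) (W e0) = hdot (mat_diag (2 ^ n) (\<lambda>i. if even i then 1 else - 1) *\<^sub>v (U *\<^sub>v e0))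
      (mat_diag (2 ^ n) (\<lambda>i. if even i then 1 else - 1) *\<^sub>v (U *\<^sub>v e0))"
    unfolding flag_reflect_def by (intro hdot_unitary[of "2 ^ n"] is_unitary_cadj oracle_unitary) simp_all
  also have "\<dots> = hdot (U *\<^sub>v e0) (U *\<^sub>v e0)"
    by (intro hdot_unitary[of "2 ^ n"] is_unitary_mat_diag) simp_all
  also have "\<dots> = hdot e0 e0"
    by (intro hdot_unitary[of "2 ^ n"] oracle_unitary) simp_all
  also have "\<dots> = 1"
    by (simp add: hdot_def if_distrib cong: if_cong)
  finally have "(\<Sum>i<2 ^ n. (cmod (W e0 $ i))\<^sup>2) = 1"
    using flag_reflect_carrier[OF e0] unfolding hdot_self by (simp flip: of_real_sum of_real_power)
  then have "(\<Sum>i\<in>{..<2 ^ n} - {0}. (cmod (W e0 $ i))\<^sup>2) = 0"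
    using flag_reflect_init c2 by (subst (asm) sum.remove[of _ 0]) auto
  then have z: "W e0 $ i = 0" if "i < 2 ^ n" "i \<noteq> 0" for i
    using that by (subst (asm) sum_nonneg_eq_0_iff) auto
  show ?thesis
    using flag_reflect_carrier[OF e0] flag_reflect_init z leak_vec_carrier True
    by (intro eq_vecI) (auto simp: unit_vec_def)
qed

lemma flag_reflect_leak:
  "W (leak_vec n c s U) = of_real s \<cdot>\<^sub>v e0 - of_real c \<cdot>\<^sub>v leak_vec n c s U"
proof -
  have e0: "e0 \<in> carrier_vec (2 ^ n)" by simp
  let ?w = "W e0"
  have l: "leak_vec n c s U = of_real (1 / s) \<cdot>\<^sub>v ?w + of_real (- c / s) \<cdot>\<^sub>v e0"
    using flag_reflect_carrier[OF e0] by (intro eq_vecI) (auto simp: leak_vec_def algebra_simps diff_divide_distrib)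
  have "W (leak_vec n c s U) = of_real (1 / s) \<cdot>\<^sub>v e0 + of_real (- c / s) \<cdot>\<^sub>v ?w"
    unfolding l using flag_reflect_carrier[OF e0] e0 by (simp add: flag_reflect_lincomb flag_reflect_involution)
  also have "\<dots> = of_real s \<cdot>\<^sub>v e0 - of_real c \<cdot>\<^sub>v leak_vec n c s U"
  proof (rule eq_vecI)
    fix i assume "i < dim_vec (of_real s \<cdot>\<^sub>v e0 - of_real c \<cdot>\<^sub>v leak_vec n c s U)"
    then have i: "i < 2 ^ n" using leak_vec_carrier by simp
    define x y where "x = e0 $ i" and "y = W e0 $ i"
    define C S where "C = complex_of_real c" and "S = complex_of_real s"
    have "S * S = 1 - C * C"
      using bias_sq unfolding S_def C_def power2_eq_square
      by (metis add_diff_cancel_left' of_real_1 of_real_diff of_real_mult)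
    then have "S * S * x = x - C * C * x"
      by (metis left_diff_distrib mult_1)
    \<comment> \<open>At \<open>S = 0\<close> both sides are 0 by the convention for division by
      zero, which matches a zero leak vector.\<close>
    then have "1 / S * x + - C / S * y = S * x - C * (1 / S * (y - C * x))"
      by (cases "S = 0") (simp_all add: field_simps)
    then show "(of_real (1 / s) \<cdot>\<^sub>v e0 + of_real (- c / s) \<cdot>\<^sub>v ?w) $ i
        = (of_real s \<cdot>\<^sub>v e0 - of_real c \<cdot>\<^sub>v leak_vec n c s U) $ i"
      using i flag_reflect_carrier[OF e0] leak_vec_carrier
      by (simp add: leak_vec_def x_def y_def C_def S_def)
  qed (use flag_reflect_carrier[OF e0] leak_vec_carrier in auto)
  finally show ?thesis .
qed

text \<open>The phase gate is \<open>Re z + i Im z Z\<close>. Conjugation by \<open>U\<close>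
  replaces \<open>Z\<close> by the flag reflection, whose action on the two spanning vectors is
  known.\<close>

lemma flag_phase_reg_vec:
  "cadj U *\<^sub>v (flag_phase n z *\<^sub>v (U *\<^sub>v reg_vec n c s U v)) = reg_vec n c s U (sig_rot c s z v)"
proof -
  have e0: "e0 \<in> carrier_vec (2 ^ n)" by simp
  let ?Z = "mat_diag (2 ^ n) (\<lambda>i. if even i then 1 else - 1 :: complex)"
  let ?v = "reg_vec n c s U v" and ?l = "leak_vec n c s U"
  have Uv: "U *\<^sub>v ?v \<in> carrier_vec (2 ^ n)" "?Z *\<^sub>v (U *\<^sub>v ?v) \<in> carrier_vec (2 ^ n)"
    using reg_vec_carrier by simp_all
  have zc: "z * y = of_real (Re z) * y + \<i> * of_real (Im z) * y"
    "cnj z * y = of_real (Re z) * y - \<i> * of_real (Im z) * y" for y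
    by (simp_all add: complex_eq_iff algebra_simps)
  have "flag_phase n z *\<^sub>v u = of_real (Re z) \<cdot>\<^sub>v u + (\<i> * of_real (Im z)) \<cdot>\<^sub>v (?Z *\<^sub>v u)"
    if "u \<in> carrier_vec (2 ^ n)" for u
    using that unfolding flag_phase_def
    by (intro eq_vecI) (auto simp: mat_diag_mult_vec zc)
  from this[OF Uv(1)] have "cadj U *\<^sub>v (flag_phase n z *\<^sub>v (U *\<^sub>v ?v))
      = of_real (Re z) \<cdot>\<^sub>v ?v + (\<i> * of_real (Im z)) \<cdot>\<^sub>v W ?v"
    using Uv reg_vec_carrier
    by (simp add: mult_mat_vec_lincomb[OF is_unitaryD(2)[OF oracle_unitary]] flag_reflect_def cadj_U_U)
  also have "W ?v = fst v \<cdot>\<^sub>v W e0 + snd v \<cdot>\<^sub>v W ?l"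
    unfolding reg_vec_def using leak_vec_carrier by (intro flag_reflect_lincomb) auto
  also have "of_real (Re z) \<cdot>\<^sub>v ?v + (\<i> * of_real (Im z)) \<cdot>\<^sub>v \<dots> = reg_vec n c s U (sig_rot c s z v)"
    unfolding flag_reflect_leak unfolding flag_reflect_e0 unfolding reg_vec_def sig_rot_def
    using leak_vec_carrier
    by (intro eq_vecI) (auto simp: algebra_simps)
  finally show ?thesis .
qed

lemma init_phase_reg_vec:
  "init_phase n z1 z2 *\<^sub>v reg_vec n c s U v = reg_vec n c s U (phases z1 z2 v)"
  unfolding init_phase_def mat_diag_mult_vec[OF reg_vec_carrier]
  using leak_vec_carrier leak_vec_0
  by (intro eq_vecI) (auto simp: reg_vec_def phases_def)

end

section \<open>Outcome statistics of a round\<close>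

definition ctrl :: "nat \<Rightarrow> complex mat \<Rightarrow> complex mat" where
  "ctrl n G = four_block_mat (1\<^sub>m (2 ^ n)) (0\<^sub>m (2 ^ n) (2 ^ n)) (0\<^sub>m (2 ^ n) (2 ^ n)) G"

text \<open>Only the known phase in the middle is controlled: with ancilla 0 the two queries compose
  to the identity, so no controlled query is needed.\<close>

definition flag_steps :: "nat \<Rightarrow> complex \<Rightarrow> step list" where
  "flag_steps n z = [Query False, Gate (ctrl n (flag_phase n z)), Query True]"

definition init_step :: "nat \<Rightarrow> complex \<Rightarrow> complex \<Rightarrow> step" where
  "init_step n z1 z2 = Gate (ctrl n (init_phase n z1 z2))"

definition macro_steps :: "nat \<Rightarrow> real \<Rightarrow> step list" where
  "macro_steps n c0 = init_step n (calib c0) (- cnj (calib c0)) # flag_steps n (cis (pi/4))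
     @ init_step n (calib c0) (cnj (calib c0)) # flag_steps n (cis (pi/4))"

text \<open>The step with equal phases multiplies the whole branch of ancilla 1 by \<open>z\<close>
  and so selects the quadrature of the interference that the Hadamard gate exposes.\<close>

definition readout :: "nat \<Rightarrow> complex \<Rightarrow> step list" where
  "readout n z = [init_step n z z, Gate (had (2 ^ n))]"

definition unitary_gates :: "nat \<Rightarrow> step list \<Rightarrow> bool" where
  "unitary_gates n cs \<longleftrightarrow> (\<forall>G. Gate G \<in> set cs \<longrightarrow> is_unitary (2 ^ (n + 1)) G)"

lemma is_unitary_ctrl: "is_unitary (2 ^ n) G \<Longrightarrow> is_unitary (2 ^ (n + 1)) (ctrl n G)"
proof -
  assume "is_unitary (2 ^ n) G"
  moreover have "is_unitary (2 ^ n) (1\<^sub>m (2 ^ n))" by (simp add: is_unitary_def)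
  ultimately show ?thesis
    using is_unitary_block_diag unfolding ctrl_def by (simp add: mult_2)
qed

lemma unitary_gates_append [simp]: "unitary_gates n (cs @ ds) \<longleftrightarrow> unitary_gates n cs \<and> unitary_gates n ds"
  by (auto simp: unitary_gates_def)

lemma unitary_gates_Cons:
  "unitary_gates n (s # cs) \<longleftrightarrow> (\<forall>G. s = Gate G \<longrightarrow> is_unitary (2 ^ (n + 1)) G) \<and> unitary_gates n cs"
  by (auto simp: unitary_gates_def)

lemma unitary_gates_Nil [simp]: "unitary_gates n []"
  by (simp add: unitary_gates_def)

lemma unitary_gates_flag_steps [simp]: "cmod z = 1 \<Longrightarrow> unitary_gates n (flag_steps n z)"
  by (simp add: flag_steps_def unitary_gates_Cons is_unitary_ctrl[simplified] is_unitary_flag_phase)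

lemma unitary_gates_init_step [simp]:
  "cmod z1 = 1 \<Longrightarrow> cmod z2 = 1 \<Longrightarrow> unitary_gates n (init_step n z1 z2 # cs) = unitary_gates n cs"
  by (simp add: init_step_def unitary_gates_Cons is_unitary_ctrl[simplified] is_unitary_init_phase)

lemma unitary_gates_macro_steps [simp]: "unitary_gates n (macro_steps n c0)"
  by (simp add: macro_steps_def)

lemma unitary_gates_readout [simp]: "cmod z = 1 \<Longrightarrow> unitary_gates n (readout n z)"
  using is_unitary_had[of "2 ^ n"] by (simp add: readout_def) (simp add: unitary_gates_Cons mult_2)

lemma unitary_gates_concat_replicate [simp]:
  "unitary_gates n cs \<Longrightarrow> unitary_gates n (concat (replicate k cs))"
  by (induction k) auto

section \<open>Expectations under the outcome distribution of a GHZ round\<close>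

definition round_exp :: "nat \<Rightarrow> complex mat \<Rightarrow> round \<Rightarrow> (outcome \<Rightarrow> real) \<Rightarrow> real" where
  "round_exp n U r f = (\<Sum>x\<in>outcomes n r. round_prob n U r x * f x)"

text \<open>Indices 0 and \<open>2 ^ n\<close> are the outcomes whose register reads all zeros, with
  ancilla 0 and 1 respectively.\<close>

definition parity_weight :: "nat \<Rightarrow> nat \<Rightarrow> real" where
  "parity_weight n i = (if i = 0 then 1 else if i = 2 ^ n then - 1 else 0)"

definition score :: "nat \<Rightarrow> nat \<Rightarrow> outcome \<Rightarrow> real" where
  "score n p x = (\<Prod>j<p. parity_weight n (x j))"

lemma abs_score_le: "\<bar>score n p x\<bar> \<le> 1"
  unfolding score_def abs_prod by (rule prod_le_1) (auto simp: parity_weight_def)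

lemma sum_PiE_power:
  fixes g :: "nat \<Rightarrow> 'a :: comm_semiring_1"
  shows "(\<Sum>x\<in>PiE {..<p} (\<lambda>_. {..<m}). \<Prod>j<p. g (x j)) = (\<Sum>i<m. g i) ^ p"
  using prod_sum_PiE[of "{..<p}" "\<lambda>_. {..<m}" "\<lambda>_. g"] by simp

text \<open>The squared GHZ amplitude consists of two branch weights and an interference term, each
  a product over the blocks, so sums over outcomes become \<open>p\<close>-th powers. A general
  \<open>\<tau>\<close> serves both normalisation and the mean score.\<close>

lemma round_exp_prod:
  fixes \<tau> :: "nat \<Rightarrow> real"
  assumes "u = run_circ n U cs (unit_vec (2 ^ (n + 1)) 0)" "v = run_circ n U cs (unit_vec (2 ^ (n + 1)) (2 ^ n))"
  shows "round_exp n U (p, \<lambda>_. cs) (\<lambda>x. \<Prod>j<p. \<tau> (x j)) =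
    ((\<Sum>i<2 ^ (n + 1). \<tau> i * (cmod (u $ i))\<^sup>2) ^ p + (\<Sum>i<2 ^ (n + 1). \<tau> i * (cmod (v $ i))\<^sup>2) ^ p) / 2
    + Re ((\<Sum>i<2 ^ (n + 1). of_real (\<tau> i) * (u $ i * cnj (v $ i))) ^ p)"
proof -
  let ?O = "PiE {..<p} (\<lambda>_. {..<2 ^ (n + 1) :: nat})"
  have sq: "(cmod (of_real (1 / sqrt 2) * (X + Y)))\<^sup>2 = ((cmod X)\<^sup>2 + (cmod Y)\<^sup>2) / 2 + Re (X * cnj Y)" for X Y
  proof -
    have "(cmod (X + Y))\<^sup>2 = (cmod X)\<^sup>2 + (cmod Y)\<^sup>2 + 2 * Re (X * cnj Y)"
      unfolding cmod_power2 by (simp add: power2_eq_square algebra_simps)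
    then show ?thesis
      by (simp add: norm_mult norm_divide power_mult_distrib power_divide)
  qed
  have "round_prob n U (p, \<lambda>_. cs) x * (\<Prod>j<p. \<tau> (x j)) =
      ((\<Prod>j<p. \<tau> (x j) * (cmod (u $ x j))\<^sup>2) + (\<Prod>j<p. \<tau> (x j) * (cmod (v $ x j))\<^sup>2)) / 2
      + Re (\<Prod>j<p. of_real (\<tau> (x j)) * (u $ x j * cnj (v $ x j)))" for x
    unfolding round_prob_def round_amp_def Let_def fst_conv snd_conv assms[symmetric] sq prod.distrib
    by (simp add: prod.distrib prod_power_distrib algebra_simps add_divide_distrib flip: of_real_prod prod_norm)
  then show ?thesis
    unfolding round_exp_def outcomes_def fst_conv
    unfolding sum_PiE_power[symmetric] by (simp add: sum.distrib flip: sum_divide_distrib)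
qed

lemma unit_vec_append:
  "unit_vec (2 ^ (n + 1)) 0 = unit_vec (2 ^ n) 0 @\<^sub>v 0\<^sub>v (2 ^ n)"
  "unit_vec (2 ^ (n + 1)) (2 ^ n) = 0\<^sub>v (2 ^ n) @\<^sub>v unit_vec (2 ^ n) 0"
  by (rule eq_vecI; auto simp: unit_vec_def)+

lemma hdot_unit_vec: "i < d \<Longrightarrow> j < d \<Longrightarrow> hdot (unit_vec d i) (unit_vec d j) = (if i = j then 1 else 0)"
proof -
  assume "i < d" "j < d"
  then have "hdot (unit_vec d i) (unit_vec d j) = (\<Sum>k<d. if k = i then if i = j then 1 else 0 else 0)"
    unfolding hdot_def by (intro sum.cong) auto
  then show ?thesis using \<open>i < d\<close> by simp
qed

lemma round_exp_1:
  assumes "is_unitary (2 ^ n) U" "unitary_gates n cs" "1 \<le> p"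
  shows "round_exp n U (p, \<lambda>_. cs) (\<lambda>_. 1) = 1"
proof -
  let ?e = "\<lambda>i. unit_vec (2 ^ (n + 1)) i :: complex vec"
  let ?u = "run_circ n U cs (?e 0)" and ?v = "run_circ n U cs (?e (2 ^ n))"
  have run: "run_circ n U cs (?e i) \<in> carrier_vec (2 ^ (n + 1))"
    "hdot (run_circ n U cs (?e i)) (run_circ n U cs (?e j)) = hdot (?e i) (?e j)" for i j
    using assms(2) unfolding unitary_gates_def
    by (intro run_circ_unitary[OF assms(1)]; blast intro: unit_vec_carrier)+
  have "hdot ?u ?u = 1" "hdot ?v ?v = 1" "hdot ?u ?v = 0"
    unfolding run by (simp_all add: hdot_unit_vec)
  then have "(\<Sum>i<2 ^ (n + 1). (cmod (?u $ i))\<^sup>2) = 1" "(\<Sum>i<2 ^ (n + 1). (cmod (?v $ i))\<^sup>2) = 1"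
    "(\<Sum>i<2 ^ (n + 1). ?u $ i * cnj (?v $ i)) = 0"
    using run(1)[of 0] run(1)[of "2 ^ n"] unfolding hdot_self of_real_eq_1_iff by (auto simp: hdot_def)
  \<comment> \<open>The interference term is a power of the vanishing inner product;
    \<open>1 \<le> p\<close> makes it 0.\<close>
  then show ?thesis
    using round_exp_prod[OF refl refl, of n U p cs "\<lambda>_. 1"] assms(3) by simp
qed

context
  fixes n :: nat and a c s :: real and U :: "complex mat"
  assumes n: "1 \<le> n" and a: "0 \<le> a" "a \<le> 1" and U: "amp_oracle n a U"
  defines "c \<equiv> 1 - 2 * a" and "s \<equiv> sqrt (1 - c\<^sup>2)"
begin

lemmas orc = n a U
lemmas orc_defs = c_def s_def

text \<open>The first register vector carries the branch of the GHZ state in which all controlled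
  phases are idle.\<close>
definition implements :: "step list \<Rightarrow> (complex \<times> complex \<Rightarrow> complex \<times> complex) \<Rightarrow> bool" where
  "implements cs T \<longleftrightarrow> (\<forall>x\<in>carrier_vec (2 ^ n). \<forall>v.
     run_circ n U cs (x @\<^sub>v reg_vec n c s U v) = x @\<^sub>v reg_vec n c s U (T v))"

lemma implementsD:
  "implements cs T \<Longrightarrow> x \<in> carrier_vec (2 ^ n) \<Longrightarrow>
    run_circ n U cs (x @\<^sub>v reg_vec n c s U v) = x @\<^sub>v reg_vec n c s U (T v)"
  unfolding implements_def by blast

lemma implements_append: "implements cs S \<Longrightarrow> implements ds T \<Longrightarrow> implements (cs @ ds) (\<lambda>v. T (S v))"
  unfolding implements_def run_circ_append by metis

lemma implements_funpow: "implements cs T \<Longrightarrow> implements (concat (replicate k cs)) (T ^^ k)"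
proof (induction k)
  case (Suc k)
  then show ?case
    using implements_append[of cs T "concat (replicate k cs)" "T ^^ k"] by (simp add: funpow_swap1 comp_def)
qed (simp add: implements_def)

lemma reg_carrier: "reg_vec n c s U v \<in> carrier_vec (2 ^ n)"
  unfolding orc_defs by (rule reg_vec_carrier[OF orc])

lemma ctrl_mult_vec:
  assumes "G \<in> carrier_mat (2 ^ n) (2 ^ n)" "x \<in> carrier_vec (2 ^ n)" "y \<in> carrier_vec (2 ^ n)"
  shows "ctrl n G *\<^sub>v (x @\<^sub>v y) = x @\<^sub>v G *\<^sub>v y"
  unfolding ctrl_def using assms by (subst block_diag_mult_vec) auto

lemma implements_init_step: "implements [init_step n z1 z2] (phases z1 z2)"
proof -
  have "init_phase n z1 z2 \<in> carrier_mat (2 ^ n) (2 ^ n)" by (simp add: init_phase_def)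
  then show ?thesis
    using init_phase_reg_vec[OF orc] reg_carrier
    by (simp add: implements_def init_step_def ctrl_mult_vec orc_defs)
qed

lemma implements_flag_steps: "implements (flag_steps n z) (sig_rot c s z)"
proof -
  note V = is_unitaryD(1,2)[OF oracle_unitary[OF orc]]
  have F: "flag_phase n z \<in> carrier_mat (2 ^ n) (2 ^ n)" by (simp add: flag_phase_def)
  have car: "M *\<^sub>v x \<in> carrier_vec (2 ^ n)" if "M \<in> carrier_mat (2 ^ n) (2 ^ n)" "x \<in> carrier_vec (2 ^ n)"
    for M and x :: "complex vec" using that by simp
  have lift: "lift_reg n M *\<^sub>v (x @\<^sub>v y) = M *\<^sub>v x @\<^sub>v M *\<^sub>v y"
    if "M \<in> carrier_mat (2 ^ n) (2 ^ n)" "x \<in> carrier_vec (2 ^ n)" "y \<in> carrier_vec (2 ^ n)" for M x y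
    using that by (simp add: lift_reg_eq block_diag_mult_vec)
  show ?thesis
    unfolding implements_def flag_steps_def
    using flag_phase_reg_vec[OF orc] reg_carrier cadj_U_U(1)[OF orc]
    by (simp add: lift V F car ctrl_mult_vec orc_defs)
qed

lemma implements_macro_steps: "implements (macro_steps n c0) (macro c s c0)"
  using implements_append[OF implements_append[OF implements_init_step implements_flag_steps]
      implements_append[OF implements_init_step implements_flag_steps]]
  unfolding macro_steps_def macro_def[abs_def] by simp

text \<open>After the Hadamard gate each branch gives both ancilla values equal weight, so the
  branch terms cancel in the parity. The interference term survives, with two equal contributions of
  one half.\<close>

lemma round_exp_score:
  assumes cs: "implements cs T" and T: "linear_isometry T" and p: "1 \<le> p"
  shows "round_exp n U (p, \<lambda>_. cs @ readout n z) (score n p) = Re ((z * fst (T (1, 0))) ^ p)"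
proof -
  let ?r = "1 / complex_of_real (sqrt 2)" and ?R = "reg_vec n c s U"
  let ?e = "unit_vec (2 ^ n) 0 :: complex vec"
  let ?u = "run_circ n U (cs @ readout n z) (unit_vec (2 ^ (n + 1)) 0)"
  let ?v = "run_circ n U (cs @ readout n z) (unit_vec (2 ^ (n + 1)) (2 ^ n))"
  \<comment> \<open>Writing the zero half of an initial vector as a \<open>reg_vec\<close> makes
    \<open>implements\<close> cover the idle branch too.\<close>
  have R0: "?R (0, 0) = 0\<^sub>v (2 ^ n)"
    using leak_vec_carrier[OF orc] by (intro eq_vecI) (auto simp: reg_vec_def orc_defs)
  have R1: "?R (1, 0) = ?e"
    unfolding orc_defs by (rule reg_vec_init[OF orc])
  have T0: "phases z z (T (0, 0)) = (0, 0)"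
    using linear_isometryD(3)[OF T, of "(0, 0)"] by (simp add: phases_def flip: zero_prod_def)
  have run: "run_circ n U (cs @ readout n z) (x @\<^sub>v ?R v)
      = ?r \<cdot>\<^sub>v (x + ?R (phases z z (T v))) @\<^sub>v ?r \<cdot>\<^sub>v (x - ?R (phases z z (T v)))"
    if "x \<in> carrier_vec (2 ^ n)" for x v
    unfolding readout_def append_Cons[of "init_step n z z" "[]", simplified] run_circ_append
      run_circ_append[of n U "[init_step n z z]", simplified append_Cons append_Nil]
      implementsD[OF cs that] implementsD[OF implements_init_step that]
    using that reg_carrier by (simp add: had_mult_vec)
  have u: "?u = ?r \<cdot>\<^sub>v ?e @\<^sub>v ?r \<cdot>\<^sub>v ?e"
    unfolding unit_vec_append R0[symmetric] by (subst run) (simp_all add: T0 R0)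
  let ?w = "?R (phases z z (T (1, 0)))"
  have v: "?v = ?r \<cdot>\<^sub>v (0\<^sub>v (2 ^ n) + ?w) @\<^sub>v ?r \<cdot>\<^sub>v (0\<^sub>v (2 ^ n) - ?w)"
    unfolding unit_vec_append R1[symmetric] by (subst run) simp_all
  have w0: "?w $ 0 = z * fst (T (1, 0))"
    using reg_vec_0[OF orc] by (simp add: orc_defs phases_def)
  have dw: "dim_vec ?w = 2 ^ n" using reg_carrier by simp
  define f g where "f = ?u" and "g = ?v"
  have at: "f $ 0 = ?r" "f $ (2 ^ n) = ?r" "g $ 0 = ?r * (z * fst (T (1, 0)))"
    "g $ (2 ^ n) = - (?r * (z * fst (T (1, 0))))"
    unfolding f_def g_def u v using dw by (simp_all add: w0)
  have sum: "(\<Sum>i<2 ^ (n + 1). of_real (parity_weight n i) * f i) = f 0 - f (2 ^ n)"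
    for f :: "nat \<Rightarrow> 'b :: real_algebra_1"
  proof -
    have "(\<Sum>i<2 ^ (n + 1). of_real (parity_weight n i) * f i)
        = (\<Sum>i\<in>{0, 2 ^ n}. of_real (parity_weight n i) * f i)"
      by (rule sum.mono_neutral_right) (auto simp: parity_weight_def)
    then show ?thesis by (simp add: parity_weight_def)
  qed
  have z: "(\<Sum>i<2 ^ (n + 1). parity_weight n i * (cmod (f $ i))\<^sup>2) = 0"
    "(\<Sum>i<2 ^ (n + 1). parity_weight n i * (cmod (g $ i))\<^sup>2) = 0"
    using sum[of "\<lambda>i. (cmod (f $ i))\<^sup>2"] sum[of "\<lambda>i. (cmod (g $ i))\<^sup>2"] by (simp_all add: at)
  have "?r * ?r = 1/2" by (simp flip: of_real_mult)
  then have fg: "(\<Sum>i<2 ^ (n + 1). of_real (parity_weight n i) * (f $ i * cnj (g $ i))) = cnj (z * fst (T (1, 0)))"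
    using sum[of "\<lambda>i. f $ i * cnj (g $ i)"] by (simp add: at)
  have "Re (cnj (z * fst (T (1, 0))) ^ p) = Re ((z * fst (T (1, 0))) ^ p)"
    by (simp flip: complex_cnj_power complex_cnj_mult)
  then show ?thesis
    using p unfolding score_def[abs_def] round_exp_prod[OF f_def g_def] z fg by (simp add: power_0_left)
qed

text \<open>The readout phase has \<open>p\<close>-th power \<open>- i\<close>, which turns the real
  part into the imaginary part: the signal becomes odd in the phase and sees the sign of
  \<open>c - c0\<close>.\<close>

lemma round_exp_macro:
  assumes "1 \<le> p"
  shows "round_exp n U (p, \<lambda>_. concat (replicate k (macro_steps n c0)) @ readout n (cis (- pi / (2 * real p)))) (score n p)
    = Im (fst ((macro c s c0 ^^ k) (1, 0)) ^ p)"
proof -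
  have "linear_isometry (macro c s c0 ^^ k)"
    unfolding orc_defs using bias_sq[OF orc] by (intro linear_isometry_funpow linear_isometry_macro)
  moreover have "cis (- pi / (2 * real p)) ^ p = - \<i>"
  proof -
    have "cis (- pi / (2 * real p)) ^ p = cis (- (pi / 2))"
      using assms unfolding DeMoivre by simp
    then show ?thesis by (simp add: complex_eq_iff)
  qed
  ultimately show ?thesis
    using round_exp_score[OF implements_funpow[OF implements_macro_steps] _ assms]
    by (simp add: power_mult_distrib)
qed

text \<open>A Hadamard test: \<open>z = i\<close> makes the flag phase \<open>i\<close> times the
  flag reflection, and the readout phase \<open>- i\<close> removes the factor. It requires no prior
  knowledge of \<open>c\<close>.\<close>

lemma round_exp_start: "round_exp n U (1, \<lambda>_. flag_steps n \<i> @ readout n (- \<i>)) (score n 1) = c"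
proof -
  have "linear_isometry (sig_rot c s \<i>)"
    unfolding orc_defs using bias_sq[OF orc] by (intro linear_isometry_sig_rot) simp_all
  from round_exp_score[OF implements_flag_steps this, of 1 "- \<i>"] show ?thesis
    by (simp add: sig_rot_def)
qed

end

section \<open>Adaptive refinement\<close>

text \<open>The jump from 1 to 128 skips the gains outside the reach of
  \<open>macro_signal_linear\<close>. Gain 1 gives stage 0 the radius 1, which covers every
  \<open>c\<close> from the centre 0.\<close>

definition stage_gain :: "nat \<Rightarrow> real" where
  "stage_gain j = (if j = 0 then 1 else 2 ^ (j + 6))"

definition stage_radius :: "nat \<Rightarrow> real" where
  "stage_radius j = 1 / stage_gain j"

text \<open>After stage 0, at most half of the gain can go into the number of blocks, since each
  block runs at least one pair of gadgets; this is the cap \<open>j + 5\<close>.\<close>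

definition stage_width :: "nat \<Rightarrow> nat \<Rightarrow> nat" where
  "stage_width l j = (if j = 0 then 1 else 2 ^ min l (j + 5))"

text \<open>Stage \<^term>\<open>j \<noteq> 0\<close> runs \<^term>\<open>2 * m\<close> macro steps on each of \<^term>\<open>p\<close> blocks with
  \<^term>\<open>2 * m * p = stage_gain j\<close>; the truncated subtraction gives \<^term>\<open>m = 1\<close> when fewer than
  \<^term>\<open>2 ^ l\<close> blocks are needed.\<close>
definition stage_circ :: "nat \<Rightarrow> nat \<Rightarrow> nat \<Rightarrow> real \<Rightarrow> step list" where
  "stage_circ n l j c0 = (if j = 0 then flag_steps n \<i> @ readout n (- \<i>)
     else concat (replicate (2 * 2 ^ (j + 5 - l)) (macro_steps n c0))
       @ readout n (cis (- pi / (2 * real (stage_width l j)))))"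

definition stage_round :: "nat \<Rightarrow> nat \<Rightarrow> nat \<Rightarrow> real \<Rightarrow> round" where
  "stage_round n l j c0 = (stage_width l j, \<lambda>_. stage_circ n l j c0)"

text \<open>The factor \<open>2\<^sup>1\<^sup>8\<close> is the inverse of the Chernoff exponent per round, and the growth
  \<^term>\<open>3 * (J - j)\<close> makes the failure probability of stage \<^term>\<open>j\<close> decay faster than the squared
  error \<^term>\<open>4 ^ (J - j)\<close> (in units of the final one) that a failure there can cause.\<close>
definition stage_len :: "nat \<Rightarrow> nat \<Rightarrow> nat" where
  "stage_len J j = 2 ^ 18 * (4 + 3 * (J - j))"

definition refine :: "nat \<Rightarrow> nat \<Rightarrow> nat \<Rightarrow> nat \<Rightarrow> real \<Rightarrow> outcome list \<Rightarrow> real" where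
  "refine n l J j c h =
     c + (\<Sum>x\<leftarrow>h. score n (stage_width l j) x) / (real (stage_len J j) * stage_gain j)"

text \<open>An algorithm sees only the flat history, so the current stage and centre are recomputed
  from it batch by batch. The one-block empty circuit is a default beyond the last batch, because
  admissibility and depth quantify over all histories.\<close>

fun choose_round :: "nat \<Rightarrow> nat \<Rightarrow> nat \<Rightarrow> nat list \<Rightarrow> real \<Rightarrow> outcome list \<Rightarrow> round" where
  "choose_round n l J [] c h = (1, \<lambda>_. [])"
| "choose_round n l J (j # js) c h =
     (if length h < stage_len J j then stage_round n l j c
      else choose_round n l J js (refine n l J j c (take (stage_len J j) h)) (drop (stage_len J j) h))"

fun estimate :: "nat \<Rightarrow> nat \<Rightarrow> nat \<Rightarrow> nat list \<Rightarrow> real \<Rightarrow> outcome list \<Rightarrow> real" where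
  "estimate n l J [] c h = (1 - c) / 2"
| "estimate n l J (j # js) c h =
     estimate n l J js (refine n l J j c (take (stage_len J j) h)) (drop (stage_len J j) h)"

definition strategy :: "nat \<Rightarrow> nat \<Rightarrow> nat \<Rightarrow> nat list \<Rightarrow> real \<Rightarrow> algo" where
  "strategy n l J js c = (\<Sum>j\<leftarrow>js. stage_len J j, choose_round n l J js c, estimate n l J js c)"

lemma stage_gain_pos [simp]: "0 < stage_gain j"
  by (simp add: stage_gain_def)

lemma stage_width_pos: "1 \<le> stage_width l j"
  by (simp add: stage_width_def)

lemma stage_len_pos: "0 < stage_len J j"
  by (simp add: stage_len_def)

lemma unitary_gates_stage_circ: "unitary_gates n (stage_circ n l j c0)"
  by (simp add: stage_circ_def)

lemma choose_round_cases:
  obtains "choose_round n l J js c h = (1, \<lambda>_. [])"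
  | j c' where "j \<in> set js" "choose_round n l J js c h = stage_round n l j c'"
proof (induction js arbitrary: c h thesis)
  case (Cons j js)
  show ?case
  proof (cases "length h < stage_len J j")
    case True
    then show ?thesis using Cons.prems(2)[of j c] by simp
  next
    case False
    then show ?thesis
      using Cons.IH[of "refine n l J j c (take (stage_len J j) h)" "drop (stage_len J j) h"] Cons.prems
      by (metis choose_round.simps(2) list.set_intros(2))
  qed
qed simp

lemma round_exp_choose_round:
  assumes "is_unitary (2 ^ n) U"
  shows "round_exp n U (choose_round n l J js c h) (\<lambda>_. 1) = 1"
proof (cases rule: choose_round_cases[of n l J js c h])
  case 1
  then show ?thesis using round_exp_1[OF assms, of "[]" 1] by simp
next
  case (2 j c')
  then show ?thesis
    unfolding stage_round_def
    using round_exp_1[OF assms unitary_gates_stage_circ stage_width_pos] by simp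
qed

section \<open>Conditional risk and its worst case\<close>

lemma round_exp_mono: "(\<And>x. f x \<le> g x) \<Longrightarrow> round_exp n U r f \<le> round_exp n U r g"
  unfolding round_exp_def by (intro sum_mono mult_left_mono) (auto simp: round_prob_def)

lemma round_exp_lincomb:
  "round_exp n U r (\<lambda>x. k * f x + m * g x) = k * round_exp n U r f + m * round_exp n U r g"
  by (simp add: round_exp_def sum.distrib sum_distrib_left algebra_simps)

lemma cond_sq_err_Suc:
  "cond_sq_err n U a A (Suc r) h = round_exp n U (fst (snd A) h) (\<lambda>x. cond_sq_err n U a A r (h @ [x]))"
  by (simp add: round_exp_def)

text \<open>Once a batch is complete, the run continues as a fresh strategy for the remaining stages
  with the refined centre; \<open>h0\<close> is that batch.\<close>

lemma cond_sq_err_shift: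
  assumes "\<And>t. fst (snd A) (h0 @ t) = fst (snd B) t" "\<And>t. snd (snd A) (h0 @ t) = snd (snd B) t"
  shows "cond_sq_err n U a A r (h0 @ h) = cond_sq_err n U a B r h"
  by (induction r arbitrary: h) (simp_all add: assms)

lemma cond_sq_err_le:
  assumes "\<And>h. round_exp n U (fst (snd A) h) (\<lambda>_. 1) = 1" "\<And>h. (snd (snd A) h - a)\<^sup>2 \<le> B"
  shows "cond_sq_err n U a A r h \<le> B"
proof (induction r arbitrary: h)
  case (Suc r)
  have "cond_sq_err n U a A (Suc r) h \<le> round_exp n U (fst (snd A) h) (\<lambda>_. B * 1 + 0 * 1)"
    unfolding cond_sq_err_Suc using Suc by (intro round_exp_mono) simp
  also have "\<dots> = B"
    unfolding round_exp_lincomb by (simp add: assms(1))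
  finally show ?case .
qed (simp add: assms(2))

lemma abs_sum_score_le: "\<bar>\<Sum>x\<leftarrow>h. score n p x\<bar> \<le> length h"
proof (induction h)
  case (Cons x h)
  then show ?case using abs_score_le[of n p x] by simp
qed simp

lemma abs_refine_le:
  assumes "length h \<le> stage_len J j"
  shows "\<bar>refine n l J j c h - c\<bar> \<le> 1 / stage_gain j"
proof -
  have "\<bar>refine n l J j c h - c\<bar> = \<bar>\<Sum>x\<leftarrow>h. score n (stage_width l j) x\<bar> / (real (stage_len J j) * stage_gain j)"
    using stage_gain_pos[of j] by (simp add: refine_def abs_mult del: stage_gain_pos)
  also have "\<dots> \<le> real (stage_len J j) / (real (stage_len J j) * stage_gain j)"
    using abs_sum_score_le[where h = h and n = n and p = "stage_width l j"] assms stage_gain_pos[of j]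
    by (intro divide_right_mono mult_nonneg_nonneg) (simp_all add: less_imp_le)
  also have "\<dots> = 1 / stage_gain j"
    using stage_len_pos[of J j] by simp
  finally show ?thesis .
qed

lemma estimate_near:
  "\<bar>estimate n l J js c h - a\<bar> \<le> (\<bar>c - (1 - 2 * a)\<bar> + (\<Sum>j\<leftarrow>js. 1 / stage_gain j)) / 2"
proof (induction js arbitrary: c h)
  case Nil
  have "(1 - c) / 2 - a = - ((c - (1 - 2 * a)) / 2)" by (simp add: field_simps)
  then have "\<bar>(1 - c) / 2 - a\<bar> = \<bar>c - (1 - 2 * a)\<bar> / 2" by (simp only: abs_minus abs_divide abs_numeral)
  then show ?case by simp
next
  case (Cons j js)
  let ?c = "refine n l J j c (take (stage_len J j) h)"
  have "\<bar>?c - c\<bar> \<le> 1 / stage_gain j" by (rule abs_refine_le) simp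
  then show ?case
    using Cons.IH[of ?c "drop (stage_len J j) h"] by simp
qed

definition risk :: "nat \<Rightarrow> nat \<Rightarrow> nat \<Rightarrow> complex mat \<Rightarrow> real \<Rightarrow> nat list \<Rightarrow> real \<Rightarrow> real" where
  "risk n l J U a js c = mse n U a (strategy n l J js c)"

lemma risk_le_radius:
  assumes "is_unitary (2 ^ n) U"
  shows "risk n l J U a js c \<le> ((\<bar>c - (1 - 2 * a)\<bar> + (\<Sum>j\<leftarrow>js. 1 / stage_gain j)) / 2)\<^sup>2"
  unfolding risk_def mse_def
proof (rule cond_sq_err_le)
  fix h
  let ?A = "strategy n l J js c"
  show "round_exp n U (fst (snd ?A) h) (\<lambda>_. 1) = 1"
    by (simp add: strategy_def round_exp_choose_round assms)
  show "(snd (snd ?A) h - a)\<^sup>2 \<le> ((\<bar>c - (1 - 2 * a)\<bar> + (\<Sum>j\<leftarrow>js. 1 / stage_gain j)) / 2)\<^sup>2"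
    using estimate_near[of n l J js c h a] unfolding strategy_def snd_conv abs_le_square_iff[symmetric]
    by linarith
qed

section \<open>Exponential moments and the Chernoff bound for a batch\<close>

lemma exp_le_quadratic:
  fixes x :: real
  assumes "\<bar>x\<bar> \<le> 1"
  shows "exp x \<le> 1 + x + x\<^sup>2"
proof (cases "0 \<le> x")
  case True
  then show ?thesis using assms exp_bound by simp
next
  case False
  define y where "y = - x"
  have y: "0 \<le> y" using False by (simp add: y_def)
  have exp_y: "1 + y + y\<^sup>2 / 2 \<le> exp y"
    using exp_lower_Taylor_quadratic[OF y] by simp
  have nonneg: "0 \<le> 1 - y + y\<^sup>2"
    using assms by (simp add: y_def)
  \<comment> \<open>For negative \<open>x\<close> the claim amounts to
    \<open>1 \<le> (1 - y + y\<^sup>2) * exp y\<close>; the quadratic Taylor polynomial of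
    \<open>exp y\<close> already suffices.\<close>
  have "1 \<le> (1 - y + y\<^sup>2) * (1 + y + y\<^sup>2 / 2)"
  proof -
    have "(1 - y + y\<^sup>2) * (1 + y + y\<^sup>2 / 2) = 1 + (y\<^sup>2 + y ^ 3 + y ^ 4) / 2"
      by (simp add: power2_eq_square power3_eq_cube power4_eq_xxxx field_simps)
    then show ?thesis using y by simp
  qed
  also have "\<dots> \<le> (1 - y + y\<^sup>2) * exp y"
    by (rule mult_left_mono[OF exp_y nonneg])
  finally show ?thesis
    by (simp add: y_def exp_minus field_simps)
qed

lemma round_exp_exp_score:
  assumes "round_exp n U r (\<lambda>_. 1) = 1" "\<bar>t\<bar> \<le> 1"
  shows "round_exp n U r (\<lambda>x. exp (t * score n p x)) \<le> exp (t * round_exp n U r (score n p) + t\<^sup>2)"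
proof -
  have "exp (t * score n p x) \<le> (1 + t\<^sup>2) * 1 + t * score n p x" for x
  proof -
    have "\<bar>t * score n p x\<bar> \<le> 1"
      using mult_mono[OF assms(2) abs_score_le[of n p x]] by (simp add: abs_mult)
    then have "exp (t * score n p x) \<le> 1 + t * score n p x + t\<^sup>2 * (score n p x)\<^sup>2"
      using exp_le_quadratic[of "t * score n p x"] by (simp add: power_mult_distrib)
    moreover have "t\<^sup>2 * (score n p x)\<^sup>2 \<le> t\<^sup>2 * 1"
      using abs_score_le[of n p x] by (intro mult_left_mono) (simp_all add: abs_square_le_1)
    ultimately show ?thesis by simp
  qed
  then have "round_exp n U r (\<lambda>x. exp (t * score n p x))
      \<le> round_exp n U r (\<lambda>x. (1 + t\<^sup>2) * 1 + t * score n p x)"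
    by (rule round_exp_mono)
  also have "\<dots> = (1 + t\<^sup>2) * 1 + t * round_exp n U r (score n p)"
    by (simp only: round_exp_lincomb assms(1))
  also have "\<dots> \<le> exp (t * round_exp n U r (score n p) + t\<^sup>2)"
    using exp_ge_add_one_self[of "t * round_exp n U r (score n p) + t\<^sup>2"] by (simp add: add_ac)
  finally show ?thesis .
qed

text \<open>Backward induction inside a batch, with \<open>V i\<close> the conditional risk when
  \<open>i\<close> rounds are left. At its end the failure indicator is dominated by two
  exponentials, one per tail, and undoing a round multiplies them by at most
  \<open>exp (t * \<mu> + t\<^sup>2)\<close> and \<open>exp (- t * \<mu> + t\<^sup>2)\<close>. Thus
  the moment bound is applied round by round, without a measure on histories.\<close>

lemma chernoff_recursion:
  assumes one: "round_exp n U r (\<lambda>_. 1) = 1" and t: "\<bar>t\<bar> \<le> 1" and T: "0 \<le> T"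
    and step: "\<And>i h. i < N \<Longrightarrow> length h = N - Suc i \<Longrightarrow> V (Suc i) h = round_exp n U r (\<lambda>x. V i (h @ [x]))"
    and base: "\<And>h. length h = N \<Longrightarrow> V 0 h \<le> G + T * (exp (t * ((\<Sum>x\<leftarrow>h. score n p x) - u)) + exp (- t * ((\<Sum>x\<leftarrow>h. score n p x) - v)))"
    and "i \<le> N" "length h = N - i"
  defines "\<mu> \<equiv> round_exp n U r (score n p)"
  shows "V i h \<le> G + T * (exp (t * ((\<Sum>x\<leftarrow>h. score n p x) - u) + real i * (t * \<mu> + t\<^sup>2))
      + exp (- t * ((\<Sum>x\<leftarrow>h. score n p x) - v) + real i * (- t * \<mu> + t\<^sup>2)))"
  using assms(6,7)
proof (induction i arbitrary: h)
  case 0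
  then show ?case using base by simp
next
  case (Suc i)
  define S where "S = (\<Sum>x\<leftarrow>h. score n p x)"
  define A where "A = exp (t * (S - u) + real i * (t * \<mu> + t\<^sup>2))"
  define B where "B = exp (- t * (S - v) + real i * (- t * \<mu> + t\<^sup>2))"
  have AB: "0 \<le> A" "0 \<le> B" by (simp_all add: A_def B_def)
  have "V i (h @ [x]) \<le> (1 * (G * 1 + (T * A) * exp (t * score n p x))) + (T * B) * exp (- t * score n p x)" for x
  proof -
    have "V i (h @ [x]) \<le> G + T * (exp (t * (S + score n p x - u) + real i * (t * \<mu> + t\<^sup>2))
      + exp (- t * (S + score n p x - v) + real i * (- t * \<mu> + t\<^sup>2)))"
      using Suc.IH[of "h @ [x]"] Suc.prems by (simp add: S_def)
    also have "\<dots> = (1 * (G * 1 + (T * A) * exp (t * score n p x))) + (T * B) * exp (- t * score n p x)"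
      by (simp add: A_def B_def algebra_simps flip: exp_add)
    finally show ?thesis .
  qed
  then have "V (Suc i) h \<le> round_exp n U r (\<lambda>x. (1 * (G * 1 + (T * A) * exp (t * score n p x))) + (T * B) * exp (- t * score n p x))"
    using step[of i h] Suc.prems by (simp only: Suc_le_eq) (rule round_exp_mono)
  also have "\<dots> = G + T * A * round_exp n U r (\<lambda>x. exp (t * score n p x)) + T * B * round_exp n U r (\<lambda>x. exp (- t * score n p x))"
    unfolding round_exp_lincomb one by simp
  also have "\<dots> \<le> G + T * A * exp (t * \<mu> + t\<^sup>2) + T * B * exp (- t * \<mu> + t\<^sup>2)"
    using round_exp_exp_score[OF one t] round_exp_exp_score[OF one, of "- t"] t T AB unfolding \<mu>_def
    by (intro add_mono mult_left_mono order_refl) simp_all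
  also have "\<dots> = G + T * (exp (t * (S - u) + real (Suc i) * (t * \<mu> + t\<^sup>2))
      + exp (- t * (S - v) + real (Suc i) * (- t * \<mu> + t\<^sup>2)))"
    by (simp add: A_def B_def algebra_simps flip: exp_add)
  finally show ?case by (simp add: S_def)
qed

lemma stage_gain_split:
  assumes "j \<noteq> 0"
  shows "stage_gain j = 2 * real (2 ^ (j + 5 - l)) * real (stage_width l j)"
proof -
  have "j + 6 = Suc ((j + 5 - l) + min l (j + 5))" by simp
  then have "(2 :: real) ^ (j + 6) = 2 * 2 ^ (j + 5 - l) * 2 ^ min l (j + 5)"
    by (simp only: power_Suc power_add mult.assoc)
  then show ?thesis
    using assms by (simp add: stage_gain_def stage_width_def)
qed

text \<open>The bias uses up half of the margin \<open>stage_gain j * stage_radius (Suc j)\<close>.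
  Stage 0 has no bias, but its test measures \<open>1 - 2 * a\<close> itself and not the distance to
  the centre, hence the centre 0.\<close>

lemma stage_signal:
  assumes "1 \<le> n" "0 \<le> a" "a \<le> 1" "amp_oracle n a U"
    and near: "\<bar>c - (1 - 2 * a)\<bar> \<le> stage_radius j" and start: "j = 0 \<Longrightarrow> c = 0"
  shows "\<bar>round_exp n U (stage_round n l j c) (score n (stage_width l j)) - stage_gain j * (1 - 2 * a - c)\<bar>
    \<le> stage_gain j * stage_radius (Suc j) / 2"
proof (cases "j = 0")
  case True
  then have "round_exp n U (stage_round n l j c) (score n (stage_width l j)) = 1 - 2 * a"
    using round_exp_start[OF assms(1-4)] by (simp add: stage_round_def stage_width_def stage_circ_def)
  then show ?thesis using True start by (simp add: stage_gain_def stage_radius_def)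
next
  case False
  let ?c = "1 - 2 * a" and ?M = "(macro (1 - 2 * a) (sqrt (1 - (1 - 2 * a)\<^sup>2)) c ^^ (2 * 2 ^ (j + 5 - l))) (1, 0)"
  have "round_exp n U (stage_round n l j c) (score n (stage_width l j)) = Im (fst ?M ^ stage_width l j)"
    using round_exp_macro[OF assms(1-4) stage_width_pos] False by (simp add: stage_round_def stage_circ_def)
  moreover have "\<bar>Im (fst ?M ^ stage_width l j) - stage_gain j * (?c - c)\<bar> \<le> 1 / 4"
  proof (rule macro_signal_linear)
    show "?c\<^sup>2 + (sqrt (1 - ?c\<^sup>2))\<^sup>2 = 1" by (rule bias_sq[OF assms(1-4)])
    show "stage_gain j = 2 * real (2 ^ (j + 5 - l)) * real (stage_width l j)"
      using False by (rule stage_gain_split)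
    have "(2 :: real) ^ 7 \<le> 2 ^ (j + 6)" using False by (intro power_increasing) auto
    then show "128 \<le> stage_gain j" using False by (simp add: stage_gain_def)
    show "\<bar>?c - c\<bar> \<le> 1 / stage_gain j"
      using near by (simp add: stage_radius_def abs_minus_commute)
  qed
  moreover have "stage_gain j * stage_radius (Suc j) / 2 = 1 / 4"
    using False by (simp add: stage_radius_def stage_gain_def power_add)
  ultimately show ?thesis by simp
qed

text \<open>Equality holds at stage 0, where the radius shrinks by the factor 128; later stages have
  margin 1/2.\<close>

lemma stage_margin: "1 / 128 \<le> stage_gain j * stage_radius (Suc j)"
  by (simp add: stage_gain_def stage_radius_def power_add)

text \<open>\<open>G\<close> bounds the later risk after a successful batch and \<open>T\<close>
  after any batch, since a refinement moves the centre by at most \<open>1 / stage_gain j\<close>.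
  The factor 2 counts the two tails.\<close>

lemma risk_step:
  assumes orc: "1 \<le> n" "0 \<le> a" "a \<le> 1" "amp_oracle n a U"
    and near: "\<bar>c - (1 - 2 * a)\<bar> \<le> stage_radius j" and start: "j = 0 \<Longrightarrow> c = 0"
    and G: "0 \<le> G" "\<And>c'. \<bar>c' - (1 - 2 * a)\<bar> \<le> stage_radius (Suc j) \<Longrightarrow> risk n l J U a js c' \<le> G"
    and T: "0 \<le> T" "\<And>c'. \<bar>c' - (1 - 2 * a)\<bar> \<le> stage_radius j + 1 / stage_gain j \<Longrightarrow> risk n l J U a js c' \<le> T"
  shows "risk n l J U a (j # js) c \<le> G + 2 * T * exp (- real (stage_len J j) / 2 ^ 18)"
proof -
  define N where "N = stage_len J j"
  define R where "R = (\<Sum>j\<leftarrow>js. stage_len J j)"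
  define A where "A = strategy n l J (j # js) c"
  define r where "r = stage_round n l j c"
  define p where "p = stage_width l j"
  define K where "K = stage_gain j"
  define \<delta> where "\<delta> = 1 - 2 * a - c"
  define \<kappa> where "\<kappa> = K * stage_radius (Suc j)"
  define \<mu> where "\<mu> = round_exp n U r (score n p)"
  define V where "V = (\<lambda>i h. cond_sq_err n U a A (i + R) h)"
  \<comment> \<open>A quarter of the least margin 1/128. With half of the margin lost to bias, the
    exponent per round is at most \<open>- t * \<kappa> / 2 + t\<^sup>2\<close>, which is
    \<open>- 1 / 2 ^ 18\<close> at that margin.\<close>
  define t where "t = (1 / 512 :: real)"
  have N: "0 < N" and K: "0 < K" by (simp_all add: N_def K_def stage_len_pos)
  have one: "round_exp n U r (\<lambda>_. 1) = 1"
    using round_exp_1[OF oracle_unitary[OF orc] unitary_gates_stage_circ stage_width_pos] by (simp add: r_def stage_round_def)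
  have V_Suc: "V (Suc i) h = round_exp n U r (\<lambda>x. V i (h @ [x]))" if "i < N" "length h = N - Suc i" for i h
  proof -
    have "fst (snd A) h = r"
      using that by (simp add: A_def strategy_def r_def N_def)
    then show ?thesis unfolding V_def add_Suc cond_sq_err_Suc by simp
  qed
  have V_0: "V 0 h \<le> G + T * (exp (t * ((\<Sum>x\<leftarrow>h. score n p x) - real N * (K * \<delta> + \<kappa>)))
      + exp (- t * ((\<Sum>x\<leftarrow>h. score n p x) - real N * (K * \<delta> - \<kappa>))))" if h: "length h = N" for h
  proof -
    define c' where "c' = refine n l J j c h"
    define S where "S = (\<Sum>x\<leftarrow>h. score n p x)"
    have "V 0 h = cond_sq_err n U a A R (h @ [])" by (simp add: V_def)
    also have "\<dots> = cond_sq_err n U a (strategy n l J js c') R []"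
      using h by (intro cond_sq_err_shift) (simp_all add: A_def strategy_def N_def c'_def)
    also have "\<dots> = risk n l J U a js c'"
      by (simp add: risk_def mse_def strategy_def R_def)
    finally have V: "V 0 h = risk n l J U a js c'" .
    \<comment> \<open>Scaling by \<open>N * K\<close> translates leaving the next radius into the
      score sum crossing \<open>N * (K * \<delta> + \<kappa>)\<close> or
      \<open>N * (K * \<delta> - \<kappa>)\<close>.\<close>
    have c': "real N * K * (c' - (1 - 2 * a)) = S - real N * (K * \<delta>)"
    proof -
      have "c' = c + S / (real N * K)"
        by (simp add: c'_def refine_def S_def N_def K_def p_def)
      then show ?thesis using N K by (simp add: \<delta>_def field_simps)
    qed
    have far: "risk n l J U a js c' \<le> T"
    proof (rule T(2))
      have "\<bar>c' - c\<bar> \<le> 1 / stage_gain j"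
        unfolding c'_def using h by (intro abs_refine_le) (simp add: N_def)
      then show "\<bar>c' - (1 - 2 * a)\<bar> \<le> stage_radius j + 1 / stage_gain j" using near by linarith
    qed
    let ?e1 = "exp (t * (S - real N * (K * \<delta> + \<kappa>)))" and ?e2 = "exp (- t * (S - real N * (K * \<delta> - \<kappa>)))"
    consider "\<bar>c' - (1 - 2 * a)\<bar> \<le> stage_radius (Suc j)" | "stage_radius (Suc j) < c' - (1 - 2 * a)"
      | "c' - (1 - 2 * a) < - stage_radius (Suc j)" by linarith
    then have "risk n l J U a js c' \<le> G + T * (?e1 + ?e2)"
    proof cases
      case 1
      then have "risk n l J U a js c' \<le> G" by (rule G(2))
      moreover have "0 \<le> T * (?e1 + ?e2)" using T(1) by simp
      ultimately show ?thesis by linarith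
    next
      case 2
      then have "real N * K * stage_radius (Suc j) \<le> real N * K * (c' - (1 - 2 * a))"
        using N K by (intro mult_left_mono) auto
      then have "0 \<le> S - real N * (K * \<delta> + \<kappa>)" unfolding c' \<kappa>_def by (simp add: algebra_simps)
      then have "1 \<le> ?e1" by (simp add: t_def)
      then have "T * 1 \<le> T * (?e1 + ?e2)" using T(1) by (intro mult_left_mono) (auto intro: add_increasing2)
      then show ?thesis using far G(1) by linarith
    next
      case 3
      then have "real N * K * (c' - (1 - 2 * a)) \<le> real N * K * (- stage_radius (Suc j))"
        using N K by (intro mult_left_mono) auto
      then have "S - real N * (K * \<delta> - \<kappa>) \<le> 0" unfolding c' \<kappa>_def by (simp add: algebra_simps)
      then have "1 \<le> ?e2" by (simp add: t_def)
      then have "T * 1 \<le> T * (?e1 + ?e2)" using T(1) by (intro mult_left_mono) (auto intro: add_increasing)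
      then show ?thesis using far G(1) by linarith
    qed
    then show ?thesis by (simp add: V S_def)
  qed
  have sig: "\<bar>\<mu> - K * \<delta>\<bar> \<le> \<kappa> / 2"
    using stage_signal[OF orc near start, of l] by (simp add: \<mu>_def r_def p_def K_def \<delta>_def \<kappa>_def)
  have "1 / 128 \<le> \<kappa>" unfolding \<kappa>_def K_def by (rule stage_margin)
  have rate: "t * (\<mu> - K * \<delta>) - t * \<kappa> + t\<^sup>2 \<le> - 1 / 2 ^ 18" "- t * (\<mu> - K * \<delta>) - t * \<kappa> + t\<^sup>2 \<le> - 1 / 2 ^ 18"
  proof -
    define D where "D = \<mu> - K * \<delta>"
    have "D \<le> \<kappa> / 2" "- D \<le> \<kappa> / 2" using sig unfolding D_def[symmetric] by linarith+
    with \<open>1 / 128 \<le> \<kappa>\<close> show "t * (\<mu> - K * \<delta>) - t * \<kappa> + t\<^sup>2 \<le> - 1 / 2 ^ 18"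
      "- t * (\<mu> - K * \<delta>) - t * \<kappa> + t\<^sup>2 \<le> - 1 / 2 ^ 18"
      unfolding D_def[symmetric] t_def power2_eq_square by simp_all
  qed
  have "V N [] \<le> G + T * (exp (t * (0 - real N * (K * \<delta> + \<kappa>)) + real N * (t * \<mu> + t\<^sup>2))
      + exp (- t * (0 - real N * (K * \<delta> - \<kappa>)) + real N * (- t * \<mu> + t\<^sup>2)))"
  proof -
    have "\<bar>t\<bar> \<le> 1" by (simp add: t_def)
    from chernoff_recursion[where V = V and N = N and i = N and h = "[]", OF one this T(1) V_Suc V_0]
    show ?thesis unfolding \<mu>_def by simp
  qed
  also have "t * (0 - real N * (K * \<delta> + \<kappa>)) + real N * (t * \<mu> + t\<^sup>2)
      = real N * (t * (\<mu> - K * \<delta>) - t * \<kappa> + t\<^sup>2)"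
    by (simp add: algebra_simps)
  also have "- t * (0 - real N * (K * \<delta> - \<kappa>)) + real N * (- t * \<mu> + t\<^sup>2)
      = real N * (- t * (\<mu> - K * \<delta>) - t * \<kappa> + t\<^sup>2)"
    by (simp add: algebra_simps)
  also have "G + T * (exp (real N * (t * (\<mu> - K * \<delta>) - t * \<kappa> + t\<^sup>2))
      + exp (real N * (- t * (\<mu> - K * \<delta>) - t * \<kappa> + t\<^sup>2)))
      \<le> G + T * (exp (real N * (- 1 / 2 ^ 18)) + exp (real N * (- 1 / 2 ^ 18)))"
  proof -
    have "exp (real N * x) \<le> exp (real N * (- 1 / 2 ^ 18))" if "x \<le> - 1 / 2 ^ 18" for x :: real
      unfolding exp_le_cancel_iff using that by (rule mult_left_mono) simp
    from add_mono[OF this[OF rate(1)] this[OF rate(2)]] show ?thesis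
      by (intro add_left_mono mult_left_mono T(1))
  qed
  also have "\<dots> = G + 2 * T * exp (- real N / 2 ^ 18)" by simp
  finally show ?thesis
    by (simp add: V_def N_def risk_def mse_def A_def R_def strategy_def)
qed

section \<open>Summing the costs of failure over the stages\<close>

lemma sum_gain_le: "(\<Sum>i\<leftarrow>[j..<m]. 1 / stage_gain i) \<le> 2 / 2 ^ j"
proof (induction "m - j" arbitrary: j)
  case (Suc k)
  then have "[j..<m] = j # [Suc j..<m]" by (simp add: upt_conv_Cons)
  moreover have "1 / stage_gain j \<le> 1 / 2 ^ j"
    by (intro divide_left_mono) (simp_all add: stage_gain_def power_increasing)
  ultimately show ?case
  proof -
    have "k = m - Suc j" using Suc(2) by simp
    from Suc(1)[OF this] have "(\<Sum>i\<leftarrow>[Suc j..<m]. 1 / stage_gain i) \<le> 1 / 2 ^ j" by simp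
    moreover have "2 / 2 ^ j = 1 / 2 ^ j + (1 / 2 ^ j :: real)" by simp
    ultimately show ?thesis
      using \<open>[j..<m] = _\<close> \<open>1 / stage_gain j \<le> _\<close> by simp
  qed
qed simp

lemma stage_radius_le: "stage_radius j \<le> 1 / 2 ^ j"
  unfolding stage_radius_def
  by (intro divide_left_mono) (simp_all add: stage_gain_def power_increasing)

lemma exp_neg_nat_le: "exp (- real (3 * k)) \<le> 1 / 8 ^ k" "exp (- 4 :: real) \<le> 1 / 16"
proof -
  have "1 / exp 1 \<le> (1 / 2 :: real)"
    using exp_ge_add_one_self[of 1] by (intro divide_left_mono) auto
  then have "exp (- 1) \<le> (1 / 2 :: real)" by (simp add: exp_minus inverse_eq_divide)
  then have "exp (- 1) ^ m \<le> (1 / 2 :: real) ^ m" for m by (intro power_mono) auto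
  then have *: "exp (- real m) \<le> (1 / 2) ^ m" for m by (simp flip: exp_of_nat_mult)
  show "exp (- 4 :: real) \<le> 1 / 16" using *[of 4] by (simp add: power_divide)
  show "exp (- real (3 * k)) \<le> 1 / 8 ^ k" using *[of "3 * k"] by (simp add: power_mult power_divide)
qed

text \<open>The term 1/64 pays for the final radius. A failure with \<open>k\<close> stages after
  the current one costs at most \<open>9 / 4 * (1 / 4) ^ j\<close> and has probability at most
  \<open>2 / 16 * (1 / 8) ^ k\<close>. As \<open>j + k = J\<close>, the product is
  \<open>(1 / 4) ^ J * 9 / 32 * (1 / 2) ^ k\<close>, a geometric series with total 9/16.\<close>

lemma risk_bound:
  assumes orc: "1 \<le> n" "0 \<le> a" "a \<le> 1" "amp_oracle n a U"
    and "j + k = Suc J" and near: "\<bar>c - (1 - 2 * a)\<bar> \<le> stage_radius j" and start: "j = 0 \<Longrightarrow> c = 0"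
  shows "risk n l J U a [j..<Suc J] c \<le> (1 / 4) ^ J * (1 / 64 + 9 / 16 * (1 - (1 / 2) ^ k))"
  using assms(5-)
proof (induction k arbitrary: j c)
  case 0
  then have j: "j = Suc J" by simp
  have "risk n l J U a [] c \<le> ((\<bar>c - (1 - 2 * a)\<bar> + 0) / 2)\<^sup>2"
    using risk_le_radius[OF oracle_unitary[OF orc], of l J a "[]" c] by simp
  also have "\<dots> \<le> (1 / 2 ^ J / 8)\<^sup>2"
  proof (intro power_mono)
    have "stage_radius j \<le> 1 / 2 ^ J / 4"
      by (simp add: j stage_radius_def stage_gain_def power_add field_simps)
    then show "(\<bar>c - (1 - 2 * a)\<bar> + 0) / 2 \<le> 1 / 2 ^ J / 8" using 0(2) by simp
  qed simp
  also have "\<dots> = (1 / 4) ^ J * (1 / 64)"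
    by (simp add: power_divide power_mult_distrib power2_eq_square flip: power_mult_distrib)
  finally show ?case using j by simp
next
  case (Suc k)
  then have jk: "J - j = k" "Suc j + k = Suc J" "[j..<Suc J] = j # [Suc j..<Suc J]"
    by (simp_all add: upt_conv_Cons)
  \<comment> \<open>Of the 3, one covers the radius and two cover this and all later refinements;
    the division by 2 passes from \<open>c\<close> to \<open>a\<close>.\<close>
  define T :: real where "T = (3 / 2 ^ j / 2)\<^sup>2"
  define G where "G = (1 / 4) ^ J * (1 / 64 + 9 / 16 * (1 - (1 / 2 :: real) ^ k))"
  have "risk n l J U a (j # [Suc j..<Suc J]) c \<le> G + 2 * T * exp (- real (stage_len J j) / 2 ^ 18)"
  proof (rule risk_step[OF orc Suc.prems(2,3)])
    show "0 \<le> G" "0 \<le> T" by (simp_all add: G_def T_def power_le_one)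
    show "risk n l J U a [Suc j..<Suc J] c' \<le> G" if "\<bar>c' - (1 - 2 * a)\<bar> \<le> stage_radius (Suc j)" for c'
      unfolding G_def using jk(2) that by (intro Suc.IH) simp_all
    show "risk n l J U a [Suc j..<Suc J] c' \<le> T" if "\<bar>c' - (1 - 2 * a)\<bar> \<le> stage_radius j + 1 / stage_gain j" for c'
    proof -
      have nn: "0 \<le> (\<Sum>i\<leftarrow>[Suc j..<Suc J]. 1 / stage_gain i)"
        by (intro sum_list_nonneg) (auto intro: less_imp_le)
      have "\<bar>c' - (1 - 2 * a)\<bar> + (\<Sum>i\<leftarrow>[Suc j..<Suc J]. 1 / stage_gain i) \<le> 3 / 2 ^ j"
        using that sum_gain_le[of j "Suc J"] stage_radius_le[of j] jk(3) by simp
      then have "((\<bar>c' - (1 - 2 * a)\<bar> + (\<Sum>i\<leftarrow>[Suc j..<Suc J]. 1 / stage_gain i)) / 2)\<^sup>2 \<le> T"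
        unfolding T_def using nn by (intro power_mono) simp_all
      then show ?thesis
        using risk_le_radius[OF oracle_unitary[OF orc], of l J a "[Suc j..<Suc J]" c'] by linarith
    qed
  qed
  also have "exp (- real (stage_len J j) / 2 ^ 18) \<le> 1 / 16 * (1 / 8 ^ k)"
  proof -
    have "exp (- real (stage_len J j) / 2 ^ 18) = exp (- 4) * exp (- real (3 * k))"
      by (simp add: stage_len_def jk(1) flip: exp_add)
    also have "\<dots> \<le> 1 / 16 * (1 / 8 ^ k)"
      by (intro mult_mono exp_neg_nat_le) simp_all
    finally show ?thesis .
  qed
  also have "2 * T * (1 / 16 * (1 / 8 ^ k)) = (1 / 4) ^ J * (9 / 32 * (1 / 2) ^ k)"
  proof -
    have J: "J = j + k" using jk(2) by simp
    have "(8 :: real) ^ k = 4 ^ k * 2 ^ k" by (simp flip: power_mult_distrib)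
    moreover have "T = 9 / 4 * (1 / 4) ^ j"
      by (simp add: T_def power_divide power2_eq_square flip: power_mult_distrib)
    ultimately show ?thesis unfolding J by (simp add: power_add power_divide)
  qed
  finally show ?case
    unfolding jk(3) G_def by (simp add: algebra_simps diff_divide_distrib T_def del: upt_Suc)
qed

section \<open>Resources\<close>

lemma strategy_ok:
  assumes "2 ^ l \<le> P"
  shows "algo_ok n P (strategy n l J js c)"
  unfolding algo_ok_def
proof
  fix h
  have "round_ok n P (choose_round n l J js c h)"
  proof (cases rule: choose_round_cases[of n l J js c h])
    case 1
    moreover have "(1 :: nat) \<le> 2 ^ l" by simp
    ultimately show ?thesis using order_trans[OF _ assms] by (simp add: round_ok_def)
  next
    case (2 j c')
    have "stage_width l j \<le> 2 ^ l"
      by (auto simp: stage_width_def intro: power_increasing)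
    then show ?thesis
      using assms stage_width_pos[of l j] unitary_gates_stage_circ[of n l j c'] 2(2)
      by (simp add: round_ok_def stage_round_def unitary_gates_def)
  qed
  then show "round_ok n P (fst (snd (strategy n l J js c)) h)"
    by (simp add: strategy_def)
qed

lemma filter_concat_replicate: "filter Q (concat (replicate k xs)) = concat (replicate k (filter Q xs))"
  by (induction k) simp_all

lemma length_concat_replicate: "length (concat (replicate k xs)) = k * length xs"
  by (induction k) simp_all

text \<open>A gadget makes four queries, so a stage after the first costs four times its gain
  however the gain is split between depth and width.\<close>

lemma stage_round_queries: "real (round_queries (stage_round n l j c)) \<le> 4 * 2 ^ (j + 6)"
proof (cases "j = 0")
  case True
  then show ?thesis
    by (simp add: round_queries_def stage_round_def stage_width_def stage_circ_def flag_steps_def readout_def init_step_def)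
next
  case False
  then have "round_queries (stage_round n l j c) = 4 * (2 * 2 ^ (j + 5 - l) * stage_width l j)"
    by (simp add: round_queries_def stage_round_def stage_circ_def filter_concat_replicate
        length_concat_replicate macro_steps_def flag_steps_def readout_def init_step_def)
  then have "real (round_queries (stage_round n l j c)) = 4 * stage_gain j"
    unfolding stage_gain_split[OF False, of l] by simp
  then show ?thesis using False by (simp add: stage_gain_def)
qed

lemma sum_lessThan_add:
  fixes f :: "nat \<Rightarrow> 'a :: comm_monoid_add"
  shows "(\<Sum>k<a + b. f k) = (\<Sum>k<a. f k) + (\<Sum>k<b. f (a + k))"
  by (induction b) (simp_all add: add.assoc)

lemma choose_round_queries:
  assumes "length hs = (\<Sum>j\<leftarrow>js. stage_len J j)"
  shows "real (\<Sum>k<(\<Sum>j\<leftarrow>js. stage_len J j). round_queries (choose_round n l J js c (take k hs)))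
    \<le> (\<Sum>j\<leftarrow>js. real (stage_len J j) * (4 * 2 ^ (j + 6)))"
  using assms
proof (induction js arbitrary: c hs)
  case (Cons j js)
  let ?r = "stage_len J j" and ?R = "\<Sum>j\<leftarrow>js. stage_len J j"
  let ?f = "\<lambda>k. real (round_queries (choose_round n l J (j # js) c (take k hs)))"
  have "(\<Sum>k<?r + ?R. ?f k) = (\<Sum>k<?r. ?f k) + (\<Sum>k<?R. ?f (?r + k))"
    by (rule sum_lessThan_add)
  also have "(\<Sum>k<?r. ?f k) \<le> (\<Sum>k<?r. 4 * 2 ^ (j + 6))"
    by (intro sum_mono) (use stage_round_queries[of n l j c] in auto)
  also have "(\<Sum>k<?R. ?f (?r + k)) \<le> (\<Sum>j\<leftarrow>js. real (stage_len J j) * (4 * 2 ^ (j + 6)))"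
  proof -
    let ?c = "refine n l J j c (take ?r hs)"
    have "?f (?r + k) = real (round_queries (choose_round n l J js ?c (take k (drop ?r hs))))" if "k < ?R" for k
      using Cons.prems that by (simp add: drop_take)
    then have "(\<Sum>k<?R. ?f (?r + k)) = (\<Sum>k<?R. real (round_queries (choose_round n l J js ?c (take k (drop ?r hs)))))"
      by (intro sum.cong) simp_all
    then show ?thesis
      using Cons.IH[of "drop ?r hs" ?c] Cons.prems by simp
  qed
  finally show ?case by simp
qed simp

text \<open>The exact value is needed for the induction: raising \<open>J\<close> doubles the old
  sum and adds \<open>4 + 3 * Suc J\<close>, which the bare bound would not absorb.\<close>

lemma weighted_geometric_sum: "(\<Sum>j<Suc J. real (4 + 3 * (J - j)) * 2 ^ j) \<le> 14 * 2 ^ J"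
proof -
  have "(\<Sum>j<Suc J. real (4 + 3 * (J - j)) * 2 ^ j) = 14 * 2 ^ J - 3 * real J - 10"
  proof (induction J)
    case (Suc J)
    have "(\<Sum>j<Suc (Suc J). real (4 + 3 * (Suc J - j)) * 2 ^ j)
        = real (4 + 3 * Suc J) + (\<Sum>j<Suc J. 2 * (real (4 + 3 * (J - j)) * 2 ^ j))"
      by (subst sum.lessThan_Suc_shift) (simp add: mult_ac del: sum.lessThan_Suc)
    also have "\<dots> = real (4 + 3 * Suc J) + 2 * (14 * 2 ^ J - 3 * real J - 10)"
      by (simp only: Suc flip: sum_distrib_left)
    finally show ?case by simp
  qed simp
  then show ?thesis by simp
qed

lemma strategy_queries: "algo_queries_le (strategy n l J [0..<Suc J] c) (2 ^ 30 * 2 ^ J)"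
  unfolding algo_queries_le_def
proof (intro allI impI)
  fix hs :: "outcome list"
  let ?A = "strategy n l J [0..<Suc J] c"
  assume "length hs = fst ?A"
  then have "real (\<Sum>k<fst ?A. round_queries (fst (snd ?A) (take k hs)))
      \<le> (\<Sum>j\<leftarrow>[0..<Suc J]. real (stage_len J j) * (4 * 2 ^ (j + 6)))"
    unfolding strategy_def fst_conv snd_conv by (rule choose_round_queries)
  also have "\<dots> = (\<Sum>j<Suc J. real (stage_len J j) * (4 * 2 ^ (j + 6)))"
    by (simp only: interv_sum_list_conv_sum_set_nat set_upt atLeast0LessThan)
  \<comment> \<open>The exponent 26 collects 18 from the batch length, 6 from the gain and 2 from
    the four queries per gain.\<close>
  also have "\<dots> = (\<Sum>j<Suc J. 2 ^ 26 * (real (4 + 3 * (J - j)) * 2 ^ j))"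
    by (intro sum.cong) (simp_all add: stage_len_def power_add)
  also have "\<dots> = 2 ^ 26 * (\<Sum>j<Suc J. real (4 + 3 * (J - j)) * 2 ^ j)"
    by (simp only: sum_distrib_left)
  also have "\<dots> \<le> 2 ^ 26 * (14 * 2 ^ J)"
    by (intro mult_left_mono weighted_geometric_sum) simp
  also have "\<dots> \<le> 2 ^ 30 * 2 ^ J" by simp
  finally show "real (\<Sum>k<fst ?A. round_queries (fst (snd ?A) (take k hs))) \<le> 2 ^ 30 * 2 ^ J" .
qed

text \<open>A gadget has 8 layers and the readout 2, so a block after stage 0 has
  \<open>16 * 2 ^ (j + 5 - l) + 2\<close>. The value 18 is that of a single pair; \<open>l\<close>
  bounds the depth of the GHZ preparation.\<close>

lemma strategy_depth:
  assumes "\<And>j. j \<in> set js \<Longrightarrow> j \<le> J"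
  shows "algo_depth_le (strategy n l J js c) (real l + 18 + 512 * 2 ^ J / 2 ^ l)"
  unfolding algo_depth_le_def
proof
  fix h
  have "real (round_depth (choose_round n l J js c h)) \<le> real l + 18 + 512 * 2 ^ J / 2 ^ l"
  proof (cases rule: choose_round_cases[of n l J js c h])
    case 1
    then show ?thesis by (simp add: round_depth_def lessThan_Suc)
  next
    case (2 j c')
    let ?w = "stage_width l j"
    have "log 2 (real ?w) \<le> real l"
      by (simp add: stage_width_def log_nat_power)
    then have "real (nat \<lceil>log 2 (real ?w)\<rceil>) \<le> real l"
      unfolding of_nat_le_iff nat_le_iff ceiling_le_iff by simp
    moreover have "Max ((\<lambda>_. length (stage_circ n l j c')) ` {..<?w}) = length (stage_circ n l j c')"
      using stage_width_pos[of l j] by (simp add: image_constant_conv lessThan_empty_iff)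
    moreover have "real (length (stage_circ n l j c')) \<le> 18 + 512 * 2 ^ J / 2 ^ l"
    proof (cases "j = 0")
      case True
      then show ?thesis by (simp add: stage_circ_def flag_steps_def readout_def)
    next
      case False
      have "(2 :: real) ^ (j + 5 - l) \<le> 1 + 2 ^ (J + 5) / 2 ^ l"
      proof (cases "l \<le> j + 5")
        case True
        then have "(2 :: real) ^ (j + 5 - l) = 2 ^ (j + 5) / 2 ^ l" by (simp add: power_diff)
        also have "\<dots> \<le> 2 ^ (J + 5) / 2 ^ l"
          using assms[OF 2(1)] by (intro divide_right_mono power_increasing) auto
        finally show ?thesis by simp
      qed simp
      moreover have "length (stage_circ n l j c') = 16 * 2 ^ (j + 5 - l) + 2"
        using False by (simp add: stage_circ_def length_concat_replicate macro_steps_def flag_steps_def readout_def)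
      ultimately show ?thesis by (simp add: power_add)
    qed
    ultimately show ?thesis
      unfolding 2(2) round_depth_def stage_round_def fst_conv snd_conv of_nat_add by linarith
  qed
  then show "real (round_depth (fst (snd (strategy n l J js c)) h)) \<le> real l + 18 + 512 * 2 ^ J / 2 ^ l"
    by (simp add: strategy_def)
qed

section \<open>Choice of the parameters\<close>

lemma algo_queries_le_mono: "algo_queries_le A M \<Longrightarrow> M \<le> N \<Longrightarrow> algo_queries_le A N"
  unfolding algo_queries_le_def using order_trans by blast

lemma algo_depth_le_mono: "algo_depth_le A M \<Longrightarrow> M \<le> N \<Longrightarrow> algo_depth_le A N"
  unfolding algo_depth_le_def using order_trans by blast

lemma ex_power_between:
  assumes "0 < \<epsilon>" "\<epsilon> < (1 :: real)"
  obtains J where "1 / \<epsilon> \<le> 2 ^ J" "2 ^ J \<le> 2 / \<epsilon>"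
proof -
  define N where "N = nat \<lceil>1 / \<epsilon>\<rceil>"
  have "1 < 1 / \<epsilon>" using assms by simp
  then have "2 \<le> N" unfolding N_def by linarith
  then obtain k where k: "2 ^ k < N" "N \<le> 2 ^ (k + 1)"
    using ex_power_ivl2[of 2 N] by auto
  have "1 / \<epsilon> \<le> real N" unfolding N_def by linarith
  also have "\<dots> \<le> 2 ^ (k + 1)" using k(2) by (metis of_nat_le_iff of_nat_numeral of_nat_power)
  finally have 1: "1 / \<epsilon> \<le> 2 ^ (k + 1)" .
  have "int (2 ^ k) < \<lceil>1 / \<epsilon>\<rceil>" using k(1) unfolding N_def by linarith
  then have "2 ^ k < 1 / \<epsilon>" by (simp add: less_ceiling_iff)
  then have "2 ^ (k + 1) \<le> 2 / \<epsilon>" by simp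
  with 1 show ?thesis by (rule that)
qed

theorem theorem1:
  "\<exists>C>0. \<forall>n\<ge>2. \<forall>\<epsilon>::real. 0 < \<epsilon> \<and> \<epsilon> < 1 \<longrightarrow> (\<forall>P::nat. 1 \<le> P \<longrightarrow>
     (\<exists>A. algo_ok n P A
        \<and> algo_queries_le A (C * (1 / \<epsilon> + real P * ln (real P)))
        \<and> algo_depth_le A (C * (1 / (\<epsilon> * real P) + ln (real P)))
        \<and> (\<forall>a U. 0 \<le> a \<and> a \<le> 1 \<and> amp_oracle n a U \<longrightarrow> sqrt (mse n U a A) < \<epsilon>)))"
proof (intro exI[of _ "2 ^ 31 :: real"] conjI allI impI)
  fix n P :: nat and \<epsilon> :: real
  assume n: "2 \<le> n" and \<epsilon>: "0 < \<epsilon> \<and> \<epsilon> < 1" and P: "1 \<le> P"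
  obtain J where J: "1 / \<epsilon> \<le> 2 ^ J" "2 ^ J \<le> 2 / \<epsilon>"
    by (rule ex_power_between[of \<epsilon>]) (use \<epsilon> in auto)
  \<comment> \<open>The largest power of two below \<open>P\<close> is at least
    \<open>P / 2\<close>; restricting to such widths loses a factor of at most 2 in depth.\<close>
  obtain l where l: "2 ^ l \<le> P" "P < 2 ^ (l + 1)"
    using ex_power_ivl1[of 2 P] P by auto
  let ?A = "strategy n l J [0..<Suc J] 0"
  have lnP: "0 \<le> ln (real P)" using P by simp
  show "\<exists>A. algo_ok n P A
        \<and> algo_queries_le A (2 ^ 31 * (1 / \<epsilon> + real P * ln (real P)))
        \<and> algo_depth_le A (2 ^ 31 * (1 / (\<epsilon> * real P) + ln (real P)))
        \<and> (\<forall>a U. 0 \<le> a \<and> a \<le> 1 \<and> amp_oracle n a U \<longrightarrow> sqrt (mse n U a A) < \<epsilon>)"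
  proof (intro exI[of _ ?A] conjI allI impI)
    show "algo_ok n P ?A" using l(1) by (rule strategy_ok)
    have "2 ^ 30 * 2 ^ J \<le> 2 ^ 30 * (2 / \<epsilon>)"
      using J(2) by (intro mult_left_mono) simp_all
    also have "\<dots> \<le> 2 ^ 31 * (1 / \<epsilon> + real P * ln (real P))"
      using lnP by simp
    finally show "algo_queries_le ?A (2 ^ 31 * (1 / \<epsilon> + real P * ln (real P)))"
      by (rule algo_queries_le_mono[OF strategy_queries])
    have depth: "real l + 18 + 512 * 2 ^ J / 2 ^ l \<le> 2 ^ 31 * (1 / (\<epsilon> * real P) + ln (real P))"
    proof -
      have "real P < 2 ^ (l + 1)" using l(2) by (metis of_nat_less_iff of_nat_numeral of_nat_power)
      then have Pl: "real P / 2 \<le> 2 ^ l" by simp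
      have "512 * 2 ^ J / 2 ^ l \<le> 512 * (2 / \<epsilon>) / (real P / 2)"
        using J(2) Pl P \<epsilon> by (intro frac_le mult_left_mono) simp_all
      then have main: "512 * 2 ^ J / 2 ^ l \<le> 2048 * (1 / (\<epsilon> * real P))" by simp
      have x: "0 \<le> 1 / (\<epsilon> * real P)" using \<epsilon> by simp
      \<comment> \<open>The constant 18 has to be absorbed. For \<open>P = 1\<close> the logarithm
        vanishes, but \<open>l = 0\<close> and \<open>1 / \<epsilon> > 1\<close>. For larger
        \<open>P\<close>, \<open>ln P \<ge> 1 / 2\<close> gives 36 and
        \<open>l \<le> 2 * ln P\<close> the remaining 2 of the 38.\<close>
      have "real l + 18 \<le> 18 * (1 / (\<epsilon> * real P)) + 38 * ln (real P)"
      proof (cases "P = 1")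
        case True
        have "l = 0"
        proof (rule ccontr)
          assume "l \<noteq> 0"
          then have "(2 :: nat) ^ 1 \<le> 2 ^ l" by (intro power_increasing) simp_all
          then show False using l(1) True by simp
        qed
        then show ?thesis using True \<epsilon> by (simp add: field_simps)
      next
        case False
        have ln2: "1 / 2 \<le> ln (2 :: real)" using exp_half_le2 by (subst ln_ge_iff) simp_all
        have "1 / 2 * real l \<le> ln 2 * real l" using ln2 by (intro mult_right_mono) simp_all
        also have "\<dots> = ln (2 ^ l)" by (simp add: ln_realpow)
        also have "\<dots> \<le> ln (real P)"
        proof (subst ln_le_cancel_iff)
          have "real (2 ^ l) \<le> real P" using l(1) by (simp only: of_nat_le_iff)
          then show "2 ^ l \<le> real P" by simp
        qed (use P in simp_all)
        finally have "real l \<le> 2 * ln (real P)" by simp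
        moreover have "ln 2 \<le> ln (real P)" using False P by simp
        ultimately show ?thesis using ln2 x by linarith
      qed
      moreover have "2048 * y + (18 * y + 38 * z) \<le> 2 ^ 31 * (y + z)" if "0 \<le> y" "0 \<le> z" for y z :: real
        using that by simp
      note this[OF x lnP]
      ultimately show ?thesis using main by linarith
    qed
    have "algo_depth_le ?A (real l + 18 + 512 * 2 ^ J / 2 ^ l)"
      by (rule strategy_depth) auto
    then show "algo_depth_le ?A (2 ^ 31 * (1 / (\<epsilon> * real P) + ln (real P)))"
      using depth by (rule algo_depth_le_mono)
    fix a U
    assume "0 \<le> a \<and> a \<le> 1 \<and> amp_oracle n a U"
    then have orc: "1 \<le> n" "0 \<le> a" "a \<le> 1" "amp_oracle n a U" using n by auto
    have "risk n l J U a [0..<Suc J] 0 \<le> (1 / 4) ^ J * (1 / 64 + 9 / 16 * (1 - (1 / 2) ^ Suc J))"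
    proof (rule risk_bound[OF orc])
      show "\<bar>0 - (1 - 2 * a)\<bar> \<le> stage_radius 0"
        using orc(2,3) by (simp add: stage_radius_def stage_gain_def abs_le_iff)
    qed simp_all
    \<comment> \<open>The constants stay below 37/64, which yields the strict inequality.\<close>
    moreover have "(1 / 4) ^ J * (1 / 64 + 9 / 16 * (1 - (1 / 2) ^ Suc J)) < (1 / 4 :: real) ^ J * 1"
    proof (intro mult_strict_left_mono)
      have "1 / 64 + 9 / 16 * (1 - x) < 1" if "0 \<le> x" for x :: real
        using that by (simp add: diff_divide_distrib)
      then show "1 / 64 + 9 / 16 * (1 - (1 / 2) ^ Suc J) < (1 :: real)"
        by (metis zero_le_divide_1_iff zero_le_numeral zero_le_power)
    qed simp
    moreover have "(1 / 4 :: real) ^ J * 1 = (1 / 2 ^ J)\<^sup>2"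
      by (simp add: power_divide power2_eq_square flip: power_mult_distrib)
    moreover have "(1 / 2 ^ J)\<^sup>2 \<le> \<epsilon>\<^sup>2"
    proof (intro power_mono)
      have "1 \<le> 2 ^ J * \<epsilon>" using J(1) \<epsilon> by (simp only: pos_divide_le_eq)
      then show "1 / 2 ^ J \<le> \<epsilon>" by (simp add: pos_divide_le_eq mult.commute)
    qed simp
    ultimately have "mse n U a ?A < \<epsilon>\<^sup>2" unfolding risk_def by linarith
    then show "sqrt (mse n U a ?A) < \<epsilon>"
      using \<epsilon> by (intro real_less_lsqrt) simp_all
  qed
qed simp

end
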